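(* For every positive integer $N$ and every $\kappa>0$, the moments $m_{2p}=m_{2p}(N,\kappa)$ of the Gaussian $\beta$ ensemble (see context) for $0\le p\le 6$ are $$m_0=N,\qquad m_2=N^2+N(-1+\kappa^{-1}),\qquad m_4=2N^3+5N^2(-1+\kappa^{-1})+N(3-5\kappa^{-1}+3\kappa^{-2}),$$ $$m_6=5N^4+22N^3(-1+\kappa^{-1})+N^2(32-54\kappa^{-1}+32\kappa^{-2})+N(-15+32\kappa^{-1}-32\kappa^{-2}+15\kappa^{-3}),$$ $$m_8=14N^5+93N^4(-1+\kappa^{-1})+N^3(234-398\kappa^{-1}+234\kappa^{-2})+N^2(-260+565\kappa^{-1}-565\kappa^{-2}+260\kappa^{-3})$$ $$\quad+N(105-260\kappa^{-1}+331\kappa^{-2}-260\kappa^{-3}+105\kappa^{-4}),$$ $$m_{10}=42N^6+386N^5(-1+\kappa^{-1})+10N^4(145-248\kappa^{-1}+145\kappa^{-2})+550N^3(-5+11\kappa^{-1}-11\kappa^{-2}+5\kappa^{-3})$$ $$\quad+N^2(2589-6545\kappa^{-1}+8395\kappa^{-2}-6545\kappa^{-3}+2589\kappa^{-4})$$ $$\quad+N(-945+2589\kappa^{-1}-3795\kappa^{-2}+3795\kappa^{-3}-2589\kappa^{-4}+945\kappa^{-5}),$$ $$m_{12}=132N^7+1586N^6(-1+\kappa^{-1})+N^5(8178-14046\kappa^{-1}+8178\kappa^{-2})$$ $$\quad+N^4(-22950+50945\kappa^{-1}-50945\kappa^{-2}+22950\kappa^{-3})$$ $$\quad+4N^3(9125-23403\kappa^{-1}+30173\kappa^{-2}-23403\kappa^{-3}+9125\kappa^{-4})$$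 $$\quad+N^2(-30669+85796\kappa^{-1}-127221\kappa^{-2}+127221\kappa^{-3}-85796\kappa^{-4}+30669\kappa^{-5})$$ $$\quad+3N(3465-10223\kappa^{-1}+16432\kappa^{-2}-18853\kappa^{-3}+16432\kappa^{-4}-10223\kappa^{-5}+3465\kappa^{-6}).$$
   Context: The Gaussian $\beta$ ensemble with $\beta=2\kappa$ is the probability law on $(\lambda_1,\dots,\lambda_N)\in\mathbb{R}^N$ with density proportional to $\prod_{l=1}^N e^{-\frac12\kappa\lambda_l^2}\prod_{1\le j<k\le N}|\lambda_k-\lambda_j|^{2\kappa}$, and $m_{2p}(N,\kappa)=\left\langle\sum_{j=1}^N\lambda_j^{2p}\right\rangle$ is the average with respect to this law. *)

theory Defs
  imports "HOL-Analysis.Analysis"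
begin

(* Points of R^N are extensional functions {..<N} -> real, with Lebesgue measure
   PiM {..<N} (\<lambda>_. lborel); this allows N to be an ordinary variable. *)

definition gbe_weight :: "nat \<Rightarrow> real \<Rightarrow> (nat \<Rightarrow> real) \<Rightarrow> real" where
  "gbe_weight N \<kappa> x =
     (\<Prod>l<N. exp (- (1/2) * \<kappa> * (x l)^2)) * (\<Prod>k<N. \<Prod>j<k. \<bar>x k - x j\<bar> powr (2 * \<kappa>))"

definition gbe_partition_function :: "nat \<Rightarrow> real \<Rightarrow> real" where
  "gbe_partition_function N \<kappa> = (\<integral>x. gbe_weight N \<kappa> x \<partial>(PiM {..<N} (\<lambda>_. lborel)))"

(* The Gaussian beta ensemble with beta = 2 * \<kappa>. *)
definition gbe :: "nat \<Rightarrow> real \<Rightarrow> (nat \<Rightarrow> real) measure" where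
  "gbe N \<kappa> = density (PiM {..<N} (\<lambda>_. lborel))
     (\<lambda>x. ennreal (gbe_weight N \<kappa> x / gbe_partition_function N \<kappa>))"

definition gbe_moment :: "nat \<Rightarrow> nat \<Rightarrow> real \<Rightarrow> real" where
  "gbe_moment q N \<kappa> = (\<integral>x. (\<Sum>j<N. x j ^ q) \<partial>(gbe N \<kappa>))"

end

theory Submission
  imports Defs "HOL-Probability.Distributions"
begin

text \<open>
  Let \<open>p\<^sub>q = \<Sum>\<^sub>l x\<^sub>l\<^sup>q\<close>, let \<open>f\<close> be a product of such power sums and let \<open>w\<close> be the unnormalised
  density. The integral of \<open>\<Sum>\<^sub>i \<partial>\<^sub>i (x\<^sub>i\<^sup>n f w)\<close> vanishes, and the interaction contributes the symmetric
  difference quotients \<open>(x\<^sub>k\<^sup>n - x\<^sub>j\<^sup>n) / (x\<^sub>k - x\<^sub>j)\<close>, which are again polynomial in power sums. This gives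
  a loop equation expressing the expectation of \<open>p\<^bsub>n+1\<^esub> f\<close> by expectations of products of power
  sums of total degree smaller by two, so it determines all moments recursively.

  For small \<open>\<kappa>\<close> the derivative of \<open>w\<close> is singular on the diagonals. The integration by parts is
  therefore carried out with \<open>\<bar>x\<^sub>k - x\<^sub>j\<bar>\<^bsup>2\<kappa>\<^esup>\<close> replaced by the smooth \<open>((x\<^sub>k - x\<^sub>j)\<^sup>2 + \<epsilon>)\<^sup>\<kappa>\<close>; after
  summation over \<open>i\<close> the integrand is dominated uniformly in \<open>\<epsilon>\<close>, and \<open>\<epsilon>\<close> can tend to 0.
\<close>

section \<open>Polynomially bounded functions and the regularised weight\<close>

definition reg_weight :: "nat \<Rightarrow> real \<Rightarrow> real \<Rightarrow> (nat \<Rightarrow> real) \<Rightarrow> real" where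
  "reg_weight N \<kappa> \<epsilon> x =
     (\<Prod>l<N. exp (- (1/2) * \<kappa> * (x l)^2)) * (\<Prod>k<N. \<Prod>j<k. ((x k - x j)^2 + \<epsilon>) powr \<kappa>)"

text \<open>The bound is a power of a single product over the coordinates, so that against the
  Gaussian factor it splits into one-dimensional estimates. It is demanded at every function,
  extensional or not, which keeps pointwise arguments free of side conditions.\<close>

definition poly_bounded :: "nat \<Rightarrow> ((nat \<Rightarrow> real) \<Rightarrow> real) \<Rightarrow> bool" where
  "poly_bounded N g \<longleftrightarrow> g \<in> borel_measurable (PiM {..<N} (\<lambda>_. lborel)) \<and>
     (\<exists>C m. \<forall>x. \<bar>g x\<bar> \<le> C * (\<Prod>l<N. 1 + (x l)^2) ^ m)"

lemma reg_weight_0: "reg_weight N \<kappa> 0 = gbe_weight N \<kappa>"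
proof -
  have "(d\<^sup>2 + 0) powr \<kappa> = \<bar>d\<bar> powr (2 * \<kappa>)" for d :: real
    using powr_powr [of "\<bar>d\<bar>" 2 \<kappa>] by simp
  then show ?thesis
    by (simp add: reg_weight_def gbe_weight_def fun_eq_iff)
qed

lemma one_le_prod_one_plus_square: "1 \<le> (\<Prod>l<N. 1 + (x l)^2 :: real)"
  by (rule prod_ge_1) auto

lemma square_le_prod_one_plus_square:
  fixes x :: "nat \<Rightarrow> real"
  assumes "k < N" shows "1 + (x k)^2 \<le> (\<Prod>l<N. 1 + (x l)^2)"
proof -
  have "(\<Prod>l<N. 1 + (x l)^2) = (1 + (x k)^2) * (\<Prod>l\<in>{..<N} - {k}. 1 + (x l)^2)"
    using assms by (intro prod.remove) auto
  moreover have "1 \<le> (\<Prod>l\<in>{..<N} - {k}. 1 + (x l)^2)"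
    by (rule prod_ge_1) auto
  ultimately show ?thesis
    using mult_left_mono [of 1 "\<Prod>l\<in>{..<N} - {k}. 1 + (x l)^2" "1 + (x k)^2"] by simp
qed

lemma coord_measurable:
  "k < N \<Longrightarrow> (\<lambda>x. x k) \<in> borel_measurable (PiM {..<N} (\<lambda>_. lborel :: real measure))"
  using measurable_component_singleton [of k "{..<N}" "\<lambda>_. lborel :: real measure"]
  by (simp add: measurable_def)

lemma poly_bounded_const: "poly_bounded N (\<lambda>_. c)"
proof -
  have "\<forall>x. \<bar>c\<bar> \<le> \<bar>c\<bar> * (\<Prod>l<N. 1 + (x l)^2) ^ 0" by simp
  moreover have "(\<lambda>_. c) \<in> borel_measurable (PiM {..<N} (\<lambda>_. lborel :: real measure))"
    by simp
  ultimately show ?thesis unfolding poly_bounded_def by blast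
qed

lemma poly_bounded_coord:
  assumes "k < N" shows "poly_bounded N (\<lambda>x. x k)"
proof -
  have "\<bar>x k\<bar> \<le> 1 * (\<Prod>l<N. 1 + (x l)^2) ^ 1" for x :: "nat \<Rightarrow> real"
  proof -
    have "\<bar>x k\<bar> \<le> 1 + (x k)^2"
      using zero_le_power2 [of "\<bar>x k\<bar> - 1"] by (auto simp: power2_eq_square algebra_simps)
    with square_le_prod_one_plus_square [OF assms, of x] show ?thesis by simp
  qed
  then show ?thesis
    using assms unfolding poly_bounded_def by (blast intro: coord_measurable)
qed

lemma poly_bounded_add:
  assumes "poly_bounded N f" "poly_bounded N g"
  shows "poly_bounded N (\<lambda>x. f x + g x)"
proof -
  obtain C m D n where
    C: "\<And>x. \<bar>f x\<bar> \<le> C * (\<Prod>l<N. 1 + (x l)^2) ^ m" and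
    D: "\<And>x. \<bar>g x\<bar> \<le> D * (\<Prod>l<N. 1 + (x l)^2) ^ n"
    using assms unfolding poly_bounded_def by blast
  \<comment> \<open>The witnesses \<open>C\<close> and \<open>D\<close> carry no sign; with absolute
    values, raising the exponent can only enlarge the bound.\<close>
  have "\<bar>f x + g x\<bar> \<le> (\<bar>C\<bar> + \<bar>D\<bar>) * (\<Prod>l<N. 1 + (x l)^2) ^ (m + n)" for x
  proof -
    let ?R = "\<Prod>l<N. 1 + (x l)^2"
    have "?R ^ m \<le> ?R ^ (m + n)" "?R ^ n \<le> ?R ^ (m + n)"
      by (intro power_increasing one_le_prod_one_plus_square; simp)+
    then have "\<bar>C\<bar> * ?R ^ m \<le> \<bar>C\<bar> * ?R ^ (m + n)" "\<bar>D\<bar> * ?R ^ n \<le> \<bar>D\<bar> * ?R ^ (m + n)"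
      by (intro mult_left_mono; simp)+
    moreover have "C * ?R ^ m \<le> \<bar>C\<bar> * ?R ^ m" "D * ?R ^ n \<le> \<bar>D\<bar> * ?R ^ n"
      using one_le_prod_one_plus_square [of x N] by (intro mult_right_mono; simp)+
    ultimately show ?thesis
      using C [of x] D [of x] abs_triangle_ineq [of "f x" "g x"] unfolding distrib_right by linarith
  qed
  moreover have "(\<lambda>x. f x + g x) \<in> borel_measurable (PiM {..<N} (\<lambda>_. lborel))"
    using assms unfolding poly_bounded_def by (intro borel_measurable_add) auto
  ultimately show ?thesis
    unfolding poly_bounded_def by blast
qed

lemma poly_bounded_mult:
  assumes "poly_bounded N f" "poly_bounded N g"
  shows "poly_bounded N (\<lambda>x. f x * g x)"
proof -
  obtain C m D n where
    C: "\<And>x. \<bar>f x\<bar> \<le> C * (\<Prod>l<N. 1 + (x l)^2) ^ m" and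
    D: "\<And>x. \<bar>g x\<bar> \<le> D * (\<Prod>l<N. 1 + (x l)^2) ^ n"
    using assms unfolding poly_bounded_def by blast
  have "\<bar>f x * g x\<bar> \<le> (C * D) * (\<Prod>l<N. 1 + (x l)^2) ^ (m + n)" for x
    using mult_mono' [OF C [of x] D [of x]] by (simp add: abs_mult power_add mult_ac)
  moreover have "(\<lambda>x. f x * g x) \<in> borel_measurable (PiM {..<N} (\<lambda>_. lborel))"
    using assms unfolding poly_bounded_def by (intro borel_measurable_times) auto
  ultimately show ?thesis
    unfolding poly_bounded_def by blast
qed

lemma poly_bounded_sum:
  "(\<And>a. a \<in> A \<Longrightarrow> poly_bounded N (f a)) \<Longrightarrow> poly_bounded N (\<lambda>x. \<Sum>a\<in>A. f a x)"
  by (induction A rule: infinite_finite_induct) (simp_all add: poly_bounded_const poly_bounded_add)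

lemma poly_bounded_power: "poly_bounded N f \<Longrightarrow> poly_bounded N (\<lambda>x. f x ^ n)"
  by (induction n) (simp_all add: poly_bounded_const poly_bounded_mult)

lemma poly_bounded_prod:
  "(\<And>a. a \<in> A \<Longrightarrow> poly_bounded N (f a)) \<Longrightarrow> poly_bounded N (\<lambda>x. \<Prod>a\<in>A. f a x)"
  by (induction A rule: infinite_finite_induct) (simp_all add: poly_bounded_const poly_bounded_mult)

lemma poly_bounded_diff:
  assumes "poly_bounded N f" "poly_bounded N g"
  shows "poly_bounded N (\<lambda>x. f x - g x)"
  using poly_bounded_add [OF assms(1) poly_bounded_mult [OF poly_bounded_const [of N "-1"] assms(2)]]
  by simp

lemma poly_bounded_dominated:
  assumes "poly_bounded N g" "f \<in> borel_measurable (PiM {..<N} (\<lambda>_. lborel))"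
    "\<And>x. \<bar>f x\<bar> \<le> \<bar>g x\<bar>"
  shows "poly_bounded N f"
  using assms unfolding poly_bounded_def by (meson order_trans)

section \<open>Measurability, monotonicity and Gaussian domination of the regularised weight\<close>

lemma diff_powr_measurable:
  fixes \<epsilon> \<kappa> :: real
  assumes "k < N" "j < N"
  shows "(\<lambda>x. ((x k - x j)^2 + \<epsilon>) powr \<kappa>) \<in> borel_measurable (PiM {..<N} (\<lambda>_. lborel))"
proof -
  have "(\<lambda>x. x k - x j) \<in> borel_measurable (PiM {..<N} (\<lambda>_. lborel :: real measure))"
    by (intro borel_measurable_diff coord_measurable assms)
  then show ?thesis
    by (rule measurable_compose [where g = "\<lambda>d. (d^2 + \<epsilon>) powr \<kappa>"]) measurable
qed

lemma reg_weight_measurable: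
  "reg_weight N \<kappa> \<epsilon> \<in> borel_measurable (PiM {..<N} (\<lambda>_. lborel))"
  unfolding reg_weight_def
  by (intro borel_measurable_times borel_measurable_prod diff_powr_measurable
      measurable_compose [OF coord_measurable, where g = "\<lambda>y. exp (- (1/2) * \<kappa> * y^2)"]) auto

lemma reg_weight_nonneg: "0 \<le> reg_weight N \<kappa> \<epsilon> x"
  unfolding reg_weight_def by (intro mult_nonneg_nonneg prod_nonneg) auto

text \<open>Makes the weight at \<open>\<epsilon> = 1\<close> an integrable majorant for the limit
  of \<open>\<epsilon>\<close> to 0.\<close>

lemma reg_weight_mono:
  assumes "0 \<le> \<epsilon>" "\<epsilon> \<le> \<delta>" "0 < \<kappa>"
  shows "reg_weight N \<kappa> \<epsilon> x \<le> reg_weight N \<kappa> \<delta> x"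
  unfolding reg_weight_def
  using assms by (intro mult_left_mono prod_mono prod_nonneg conjI powr_mono2) auto

text \<open>This is \<open>t \<le> exp t\<close> at \<open>t = u / m\<close>, raised to the power
  \<open>m\<close>.\<close>

lemma power_le_exp:
  fixes u :: real
  assumes "0 \<le> u" shows "u ^ m \<le> real m ^ m * exp u"
proof (cases "m = 0")
  case False
  have "u / m \<le> exp (u / m)"
    using exp_ge_add_one_self [of "u / m"] by linarith
  then have "u \<le> m * exp (u / m)"
    using False by (simp add: field_simps)
  then have "u ^ m \<le> (m * exp (u / m)) ^ m"
    using assms by (intro power_mono) auto
  also have "\<dots> = real m ^ m * exp u"
    using False by (simp add: power_mult_distrib flip: exp_of_nat_mult)
  finally show ?thesis .
qed (simp add: assms)

text \<open>The decay rate \<open>\<kappa>/2\<close> is spent in halves: one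
  \<open>\<kappa>/4\<close> absorbs the polynomial by the previous lemma, the other survives as a
  Gaussian.\<close>

lemma power_times_gaussian_le:
  fixes y :: real
  assumes "0 < \<kappa>"
  shows "(1 + y\<^sup>2) ^ m * exp (- (1/2) * \<kappa> * y\<^sup>2)
    \<le> real m ^ m * exp (\<kappa>/4) / (\<kappa>/4) ^ m * exp (- (\<kappa>/4) * y\<^sup>2)"
proof -
  have "(\<kappa>/4 * (1 + y\<^sup>2)) ^ m \<le> real m ^ m * exp (\<kappa>/4 * (1 + y\<^sup>2))"
    using assms by (intro power_le_exp) auto
  then have "(1 + y\<^sup>2) ^ m \<le> real m ^ m * exp (\<kappa>/4 * (1 + y\<^sup>2)) / (\<kappa>/4) ^ m"
    using assms by (simp only: power_mult_distrib) (simp add: pos_le_divide_eq mult_ac)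
  then have "(1 + y\<^sup>2) ^ m * exp (- (1/2) * \<kappa> * y\<^sup>2)
      \<le> real m ^ m * exp (\<kappa>/4 * (1 + y\<^sup>2)) / (\<kappa>/4) ^ m * exp (- (1/2) * \<kappa> * y\<^sup>2)"
    by (intro mult_right_mono) auto
  also have "\<dots> = real m ^ m / (\<kappa>/4) ^ m * exp (\<kappa>/4 * (1 + y\<^sup>2) + - (1/2) * \<kappa> * y\<^sup>2)"
    by (subst exp_add) simp
  also have "\<kappa>/4 * (1 + y\<^sup>2) + - (1/2) * \<kappa> * y\<^sup>2 = \<kappa>/4 + - (\<kappa>/4) * y\<^sup>2"
    by (simp add: field_simps)
  also have "exp \<dots> = exp (\<kappa>/4) * exp (- (\<kappa>/4) * y\<^sup>2)"
    by (rule exp_add)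
  finally show ?thesis by simp
qed

text \<open>Raising \<open>\<epsilon>\<close> to 1 makes every base at least 1; the real exponent
  \<open>\<kappa>\<close> may then be rounded up to an integer, which leaves a polynomial.\<close>

lemma vandermonde_poly_bounded:
  assumes "0 \<le> \<epsilon>" "\<epsilon> \<le> 1" "0 < \<kappa>"
  shows "poly_bounded N (\<lambda>x. \<Prod>k<N. \<Prod>j<k. ((x k - x j)^2 + \<epsilon>) powr \<kappa>)"
proof (intro poly_bounded_prod)
  fix k j assume "k \<in> {..<N}" "j \<in> {..<k}"
  then have *: "k < N" "j < N" by auto
  show "poly_bounded N (\<lambda>x. ((x k - x j)^2 + \<epsilon>) powr \<kappa>)"
  proof (rule poly_bounded_dominated [where g = "\<lambda>x. ((x k - x j)^2 + 1) ^ nat \<lceil>\<kappa>\<rceil>"])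
    show "poly_bounded N (\<lambda>x. ((x k - x j)^2 + 1) ^ nat \<lceil>\<kappa>\<rceil>)"
      using * by (intro poly_bounded_power poly_bounded_add poly_bounded_diff poly_bounded_const poly_bounded_coord)
    show "(\<lambda>x. ((x k - x j)^2 + \<epsilon>) powr \<kappa>) \<in> borel_measurable (PiM {..<N} (\<lambda>_. lborel))"
      using * by (rule diff_powr_measurable)
    fix x :: "nat \<Rightarrow> real"
    have "((x k - x j)^2 + \<epsilon>) powr \<kappa> \<le> ((x k - x j)^2 + 1) powr \<kappa>"
      using assms by (intro powr_mono2) auto
    also have "\<dots> \<le> ((x k - x j)^2 + 1) powr real (nat \<lceil>\<kappa>\<rceil>)"
      using assms by (intro powr_mono) (auto simp: of_nat_ceiling)
    also have "\<dots> = ((x k - x j)^2 + 1) ^ nat \<lceil>\<kappa>\<rceil>"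
      by (intro powr_realpow) (simp add: add_nonneg_pos)
    finally show "\<bar>((x k - x j)^2 + \<epsilon>) powr \<kappa>\<bar> \<le> \<bar>((x k - x j)^2 + 1) ^ nat \<lceil>\<kappa>\<rceil>\<bar>"
      by (simp add: order_trans [OF _ abs_ge_self])
  qed
qed

text \<open>The central estimate: it yields integrability and also the decay that removes boundary
  terms in the integration by parts.\<close>

lemma poly_bounded_times_weight_le:
  assumes "0 \<le> \<epsilon>" "\<epsilon> \<le> 1" "0 < \<kappa>" "poly_bounded N g"
  obtains C where "\<And>x. \<bar>g x * reg_weight N \<kappa> \<epsilon> x\<bar> \<le> C * (\<Prod>l<N. exp (- (\<kappa>/4) * (x l)\<^sup>2))"
proof -
  let ?V = "\<lambda>x. \<Prod>k<N. \<Prod>j<k. ((x k - x j)^2 + \<epsilon>) powr \<kappa>"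
  have "poly_bounded N (\<lambda>x. g x * ?V x)"
    using assms by (intro poly_bounded_mult vandermonde_poly_bounded)
  then obtain C m where C: "\<And>x. \<bar>g x * ?V x\<bar> \<le> C * (\<Prod>l<N. 1 + (x l)^2) ^ m"
    unfolding poly_bounded_def by blast
  let ?K = "real m ^ m * exp (\<kappa>/4) / (\<kappa>/4) ^ m"
  have "\<bar>g x * reg_weight N \<kappa> \<epsilon> x\<bar> \<le> (\<bar>C\<bar> * ?K ^ N) * (\<Prod>l<N. exp (- (\<kappa>/4) * (x l)\<^sup>2))" for x
  proof -
    let ?G = "\<Prod>l<N. exp (- (1/2) * \<kappa> * (x l)^2)"
    have G: "0 \<le> ?G" by (intro prod_nonneg) auto
    have "\<bar>g x * reg_weight N \<kappa> \<epsilon> x\<bar> = \<bar>g x * ?V x\<bar> * ?G"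
      unfolding reg_weight_def using G by (simp add: abs_mult mult_ac)
    also have "\<dots> \<le> (C * (\<Prod>l<N. 1 + (x l)^2) ^ m) * ?G"
      by (intro mult_right_mono C G)
    also have "\<dots> \<le> (\<bar>C\<bar> * (\<Prod>l<N. 1 + (x l)^2) ^ m) * ?G"
      using one_le_prod_one_plus_square [of x N] by (intro mult_right_mono G) auto
    also have "\<dots> = \<bar>C\<bar> * (\<Prod>l<N. (1 + (x l)^2) ^ m * exp (- (1/2) * \<kappa> * (x l)^2))"
      by (simp add: prod.distrib prod_power_distrib)
    also have "\<dots> \<le> \<bar>C\<bar> * (\<Prod>l<N. ?K * exp (- (\<kappa>/4) * (x l)\<^sup>2))"
      using assms by (intro mult_left_mono prod_mono conjI power_times_gaussian_le) auto
    also have "\<dots> = (\<bar>C\<bar> * ?K ^ N) * (\<Prod>l<N. exp (- (\<kappa>/4) * (x l)\<^sup>2))"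
      by (simp only: prod.distrib prod_constant card_lessThan mult.assoc)
    finally show ?thesis .
  qed
  then show ?thesis by (rule that)
qed

lemma integrable_gaussian:
  fixes a :: real
  assumes "0 < a" shows "integrable lborel (\<lambda>y. exp (- a * y\<^sup>2))"
proof -
  \<comment> \<open>The standard deviation for which the normal density has exponent
    \<open>- a * y\<^sup>2\<close>.\<close>
  let ?s = "sqrt (1 / (2 * a))"
  have "integrable lborel (\<lambda>y. sqrt (2 * pi * ?s\<^sup>2) * normal_density 0 ?s y)"
    using assms by (intro integrable_mult_right integrable_normal_density) auto
  also have "(\<lambda>y. sqrt (2 * pi * ?s\<^sup>2) * normal_density 0 ?s y) = (\<lambda>y. exp (- a * y\<^sup>2))"
    using assms by (simp add: normal_density_def fun_eq_iff field_simps real_sqrt_mult)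
  finally show ?thesis .
qed

lemma integrable_prod_gaussian:
  fixes a :: real and N :: nat
  assumes "0 < a"
  shows "integrable (PiM {..<N} (\<lambda>_. lborel)) (\<lambda>x. \<Prod>l<N. exp (- a * (x l)\<^sup>2))"
proof -
  interpret product_sigma_finite "\<lambda>_ :: nat. lborel :: real measure" ..
  show ?thesis
    using assms
    by (intro product_integrable_prod [where f = "\<lambda>_ y. exp (- a * y\<^sup>2)"] integrable_gaussian) auto
qed

lemma integrable_gaussian_bound:
  fixes a :: real and N :: nat
  assumes "0 < a" "f \<in> borel_measurable (PiM {..<N} (\<lambda>_. lborel))"
    "\<And>x. \<bar>f x\<bar> \<le> C * (\<Prod>l<N. exp (- a * (x l)\<^sup>2))"
  shows "integrable (PiM {..<N} (\<lambda>_. lborel)) f"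
proof (rule Bochner_Integration.integrable_bound)
  show "integrable (PiM {..<N} (\<lambda>_. lborel)) (\<lambda>x. C * (\<Prod>l<N. exp (- a * (x l)\<^sup>2)))"
    by (rule integrable_mult_right [OF integrable_prod_gaussian [OF assms(1)]])
  show "AE x in PiM {..<N} (\<lambda>_. lborel). norm (f x) \<le> norm (C * (\<Prod>l<N. exp (- a * (x l)\<^sup>2)))"
    using order_trans [OF assms(3) abs_ge_self] by (simp only: real_norm_def AE_I2)
qed (rule assms)

lemma integrable_poly_bounded:
  assumes "0 \<le> \<epsilon>" "\<epsilon> \<le> 1" "0 < \<kappa>" "poly_bounded N g"
  shows "integrable (PiM {..<N} (\<lambda>_. lborel)) (\<lambda>x. g x * reg_weight N \<kappa> \<epsilon> x)"
proof -
  obtain C where "\<And>x. \<bar>g x * reg_weight N \<kappa> \<epsilon> x\<bar> \<le> C * (\<Prod>l<N. exp (- (\<kappa>/4) * (x l)\<^sup>2))"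
    using poly_bounded_times_weight_le [OF assms] by blast
  moreover have "(\<lambda>x. g x * reg_weight N \<kappa> \<epsilon> x) \<in> borel_measurable (PiM {..<N} (\<lambda>_. lborel))"
    using assms(4) unfolding poly_bounded_def by (intro borel_measurable_times reg_weight_measurable) auto
  ultimately show ?thesis
    using assms(3) by (intro integrable_gaussian_bound [of "\<kappa>/4" _ N C]) (simp_all only: zero_less_divide_iff, simp_all)
qed

section \<open>Integration by parts in one coordinate\<close>

text \<open>Quantifying over all points makes \<open>F'\<close> a function on the same space as
  \<open>F\<close>, so derivatives compose by algebra on functions, and the derivative along a whole
  coordinate line is an instance (\<open>has_partialD\<close>).\<close>

definition has_partial :: "nat \<Rightarrow> ((nat \<Rightarrow> real) \<Rightarrow> real) \<Rightarrow> ((nat \<Rightarrow> real) \<Rightarrow> real) \<Rightarrow> bool" where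
  "has_partial i F F' \<longleftrightarrow> (\<forall>x. ((\<lambda>y. F (x(i := y))) has_real_derivative F' x) (at (x i)))"

section \<open>Rules of calculus for partial derivatives\<close>

lemma has_partial_const: "has_partial i (\<lambda>_. c) (\<lambda>_. 0)"
  unfolding has_partial_def by simp

lemma has_partial_coord: "has_partial i (\<lambda>x. x l) (\<lambda>_. of_bool (l = i))"
  unfolding has_partial_def by (cases "l = i") simp_all

lemma has_partial_add:
  "has_partial i F F' \<Longrightarrow> has_partial i G G' \<Longrightarrow> has_partial i (\<lambda>x. F x + G x) (\<lambda>x. F' x + G' x)"
  unfolding has_partial_def by (auto intro: DERIV_add)

lemma has_partial_diff:
  "has_partial i F F' \<Longrightarrow> has_partial i G G' \<Longrightarrow> has_partial i (\<lambda>x. F x - G x) (\<lambda>x. F' x - G' x)"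
  unfolding has_partial_def by (auto intro: DERIV_diff)

lemma has_partial_sum:
  "(\<And>a. a \<in> A \<Longrightarrow> has_partial i (F a) (F' a)) \<Longrightarrow>
    has_partial i (\<lambda>x. \<Sum>a\<in>A. F a x) (\<lambda>x. \<Sum>a\<in>A. F' a x)"
  unfolding has_partial_def by (auto intro: DERIV_sum)

lemma has_partial_mult:
  "has_partial i F F' \<Longrightarrow> has_partial i G G' \<Longrightarrow>
    has_partial i (\<lambda>x. F x * G x) (\<lambda>x. F' x * G x + F x * G' x)"
  unfolding has_partial_def
  by (auto intro!: derivative_eq_intros simp: fun_upd_triv)

lemma has_partial_chain:
  assumes "has_partial i F F'" "\<And>x. (\<phi> has_real_derivative \<phi>' x) (at (F x))"
  shows "has_partial i (\<lambda>x. \<phi> (F x)) (\<lambda>x. \<phi>' x * F' x)"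
  unfolding has_partial_def
proof
  fix x
  show "((\<lambda>y. \<phi> (F (x(i := y)))) has_real_derivative \<phi>' x * F' x) (at (x i))"
    using assms(1) assms(2) [of x] unfolding has_partial_def
    by (intro DERIV_chain2 [where f = \<phi>]) (auto simp: fun_upd_triv)
qed

lemma has_partialD:
  "has_partial i F F' \<Longrightarrow> ((\<lambda>y. F (x(i := y))) has_real_derivative F' (x(i := y))) (at y)"
  unfolding has_partial_def by (auto dest!: spec [of _ "x(i := y)"])

text \<open>The fundamental theorem on \<open>[-n, n]\<close> gives boundary values that tend to 0,
  while dominated convergence with majorant \<open>\<bar>G'\<bar>\<close> takes the left side to the
  full integral.\<close>

lemma integral_deriv_eq_0:
  fixes G G' :: "real \<Rightarrow> real"
  assumes der: "\<And>y. (G has_real_derivative G' y) (at y)" and int: "integrable lborel G'"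
    and lim: "(G \<longlongrightarrow> 0) at_top" "(G \<longlongrightarrow> 0) at_bot"
  shows "(\<integral>y. G' y \<partial>lborel) = 0"
proof -
  have FTC: "(LINT y:{- real n..real n}|lborel. G' y) = G (real n) - G (- real n)" for n
  proof -
    have "set_integrable lborel {- real n..real n} G'"
      using int unfolding set_integrable_def by (intro integrable_mult_indicator) auto
    then have "(LINT y:{- real n..real n}|lborel. G' y) = integral {- real n..real n} G'"
      by (rule set_borel_integral_eq_integral)
    also have "\<dots> = G (real n) - G (- real n)"
      using der by (intro integral_unique fundamental_theorem_of_calculus)
        (auto simp flip: has_real_derivative_iff_has_vector_derivative intro: has_field_derivative_at_within)
    finally show ?thesis .
  qed
  have "(\<lambda>n. LINT y:{- real n..real n}|lborel. G' y) \<longlonglongrightarrow> (\<integral>y. G' y \<partial>lborel)"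
    unfolding set_lebesgue_integral_def
  proof (rule integral_dominated_convergence [where w = "\<lambda>y. \<bar>G' y\<bar>"])
    show "AE y in lborel. (\<lambda>n. indicator {- real n..real n} y *\<^sub>R G' y) \<longlonglongrightarrow> G' y"
    proof (rule AE_I2, rule tendsto_eventually)
      fix y :: real
      obtain m where "\<bar>y\<bar> \<le> real m"
        using real_arch_simple by blast
      then show "\<forall>\<^sub>F n in sequentially. indicator {- real n..real n} y *\<^sub>R G' y = G' y"
        by (intro eventually_sequentiallyI [of m]) (auto simp: indicator_def)
    qed
  qed (use int in \<open>auto split: split_indicator\<close>)
  moreover have "(\<lambda>n. G (real n) - G (- real n)) \<longlonglongrightarrow> 0 - 0"
  proof (rule tendsto_diff)
    show "(\<lambda>n. G (real n)) \<longlonglongrightarrow> 0"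
      by (rule filterlim_compose [OF lim(1) filterlim_real_sequentially])
    show "(\<lambda>n. G (- real n)) \<longlonglongrightarrow> 0"
      by (rule filterlim_compose [OF lim(2)])
        (simp add: filterlim_uminus_at_bot filterlim_real_sequentially)
  qed
  ultimately show ?thesis
    by (simp add: FTC LIMSEQ_unique)
qed

lemma gaussian_tendsto_0:
  fixes a :: real
  assumes "0 < a"
  shows "((\<lambda>y. exp (- a * y\<^sup>2)) \<longlongrightarrow> 0) at_top" "((\<lambda>y. exp (- a * y\<^sup>2)) \<longlongrightarrow> 0) at_bot"
  using assms by real_asymp+

text \<open>By Fubini coordinate \<open>i\<close> is integrated first. On each line the Gaussian
  bound on \<open>F'\<close> gives integrability and the one on \<open>F\<close> gives vanishing at
  both ends, so the inner integral is already 0.\<close>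

lemma integral_partial_eq_0:
  fixes a :: real
  assumes "0 < a" "i < N" and partial: "has_partial i F F'"
    and meas: "F' \<in> borel_measurable (PiM {..<N} (\<lambda>_. lborel))"
    and F: "\<And>x. \<bar>F x\<bar> \<le> C * (\<Prod>l<N. exp (- a * (x l)\<^sup>2))"
    and F': "\<And>x. \<bar>F' x\<bar> \<le> C' * (\<Prod>l<N. exp (- a * (x l)\<^sup>2))"
  shows "(\<integral>x. F' x \<partial>(PiM {..<N} (\<lambda>_. lborel))) = 0"
proof -
  interpret product_sigma_finite "\<lambda>_ :: nat. lborel :: real measure" ..
  let ?I = "{..<N} - {i}"
  have ins: "{..<N} = insert i ?I" using assms(2) by auto
  have int: "integrable (PiM {..<N} (\<lambda>_. lborel)) F'"
    using assms(1) meas F' by (rule integrable_gaussian_bound)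
  have prod: "(\<Prod>l<N. exp (- a * ((x(i := y)) l)\<^sup>2)) = (\<Prod>l\<in>?I. exp (- a * (x l)\<^sup>2)) * exp (- a * y\<^sup>2)"
    for x :: "nat \<Rightarrow> real" and y
  proof -
    have "(\<Prod>l<N. exp (- a * ((x(i := y)) l)\<^sup>2))
        = exp (- a * ((x(i := y)) i)\<^sup>2) * (\<Prod>l\<in>?I. exp (- a * ((x(i := y)) l)\<^sup>2))"
      using assms(2) by (intro prod.remove) auto
    also have "(\<Prod>l\<in>?I. exp (- a * ((x(i := y)) l)\<^sup>2)) = (\<Prod>l\<in>?I. exp (- a * (x l)\<^sup>2))"
      by (intro prod.cong) auto
    finally show ?thesis by simp
  qed
  have "(\<integral>x. F' x \<partial>(PiM {..<N} (\<lambda>_. lborel))) = (\<integral>x. (\<integral>y. F' (x(i := y)) \<partial>lborel) \<partial>(PiM ?I (\<lambda>_. lborel)))"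
    using product_integral_insert [of ?I i F', folded ins] int by simp
  also have "\<dots> = (\<integral>x. 0 \<partial>(PiM ?I (\<lambda>_. lborel :: real measure)))"
  proof (rule Bochner_Integration.integral_cong [OF refl])
    fix x assume x: "x \<in> space (PiM ?I (\<lambda>_. lborel :: real measure))"
    let ?K = "\<Prod>l\<in>?I. exp (- a * (x l)\<^sup>2)"
    have G: "\<bar>F (x(i := y))\<bar> \<le> (C * ?K) * exp (- a * y\<^sup>2)"
      and G': "\<bar>F' (x(i := y))\<bar> \<le> (C' * ?K) * exp (- a * y\<^sup>2)" for y
      using F [of "x(i := y)"] F' [of "x(i := y)"] unfolding prod by (simp_all only: mult.assoc)
    show "(\<integral>y. F' (x(i := y)) \<partial>lborel) = 0"
    proof (rule integral_deriv_eq_0)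
      show "((\<lambda>y. F (x(i := y))) has_real_derivative F' (x(i := y))) (at y)" for y
        by (rule has_partialD [OF partial])
      have "(\<lambda>y. x(i := y)) \<in> measurable lborel (PiM (insert i ?I) (\<lambda>_. lborel))"
        using measurable_component_update [OF x, of i] by simp
      from this [folded ins]
      have m: "(\<lambda>y. F' (x(i := y))) \<in> borel_measurable lborel"
        using meas by (rule measurable_compose)
      have "integrable lborel (\<lambda>y. (C' * ?K) * exp (- a * y\<^sup>2))"
        by (rule integrable_mult_right [OF integrable_gaussian [OF assms(1)]])
      moreover have "AE y in lborel. norm (F' (x(i := y))) \<le> norm ((C' * ?K) * exp (- a * y\<^sup>2))"
        by (rule AE_I2) (simp only: real_norm_def order_trans [OF G' abs_ge_self])
      ultimately show "integrable lborel (\<lambda>y. F' (x(i := y)))"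
        by (rule Bochner_Integration.integrable_bound [OF _ m])
      show "((\<lambda>y. F (x(i := y))) \<longlongrightarrow> 0) at_top"
        using tendsto_mult_right_zero [OF gaussian_tendsto_0(1) [OF assms(1)], of "C * ?K"]
        by (rule Lim_null_comparison [rotated]) (simp only: real_norm_def G eventually_True)
      show "((\<lambda>y. F (x(i := y))) \<longlongrightarrow> 0) at_bot"
        using tendsto_mult_right_zero [OF gaussian_tendsto_0(2) [OF assms(1)], of "C * ?K"]
        by (rule Lim_null_comparison [rotated]) (simp only: real_norm_def G eventually_True)
    qed
  qed
  finally show ?thesis by simp
qed

text \<open>For positive \<open>\<epsilon>\<close> no base vanishes, so logarithms are available and
  the weight can be differentiated as the exponential of a sum.\<close>

lemma reg_weight_eq_exp:
  assumes "0 < \<epsilon>"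
  shows "reg_weight N \<kappa> \<epsilon> x =
    exp ((\<Sum>l<N. - (1/2) * \<kappa> * (x l)\<^sup>2) + (\<Sum>k<N. \<Sum>j<k. \<kappa> * ln ((x k - x j)\<^sup>2 + \<epsilon>)))"
proof -
  have "(x k - x j)\<^sup>2 + \<epsilon> \<noteq> 0" for k j
    using assms by (smt (verit) zero_le_power2)
  then show ?thesis
    unfolding reg_weight_def by (simp add: exp_add exp_sum powr_def)
qed

text \<open>The weight times its logarithmic derivative. The difference of indicators is the
  derivative of \<open>x k - x j\<close>; keeping it unevaluated avoids a case distinction on the
  position of \<open>i\<close> and prepares the summation over \<open>i\<close>.\<close>

lemma has_partial_reg_weight:
  assumes "0 < \<epsilon>"
  shows "has_partial i (reg_weight N \<kappa> \<epsilon>)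
    (\<lambda>x. reg_weight N \<kappa> \<epsilon> x * ((\<Sum>l<N. - \<kappa> * (x l * of_bool (l = i))) +
       (\<Sum>k<N. \<Sum>j<k. \<kappa> * (2 * (x k - x j) / ((x k - x j)\<^sup>2 + \<epsilon>)) * (of_bool (k = i) - of_bool (j = i)))))"
proof -
  have "has_partial i (\<lambda>x. - (1/2) * \<kappa> * (x l)\<^sup>2) (\<lambda>x. - \<kappa> * (x l * of_bool (l = i)))" for l
  proof -
    have "((\<lambda>y. - (1/2) * \<kappa> * y\<^sup>2) has_real_derivative - \<kappa> * x l) (at (x l))" for x :: "nat \<Rightarrow> real"
      by (auto intro!: derivative_eq_intros)
    from has_partial_chain [OF has_partial_coord this] show ?thesis
      by (simp only: mult.assoc)
  qed
  moreover have "has_partial i (\<lambda>x. \<kappa> * ln ((x k - x j)\<^sup>2 + \<epsilon>))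
      (\<lambda>x. \<kappa> * (2 * (x k - x j) / ((x k - x j)\<^sup>2 + \<epsilon>)) * (of_bool (k = i) - of_bool (j = i)))" for k j
  proof (rule has_partial_chain [where \<phi> = "\<lambda>d. \<kappa> * ln (d\<^sup>2 + \<epsilon>)"])
    show "has_partial i (\<lambda>x. x k - x j) (\<lambda>x. of_bool (k = i) - of_bool (j = i))"
      by (intro has_partial_diff has_partial_coord)
    have "0 < d\<^sup>2 + \<epsilon>" for d using assms by (simp add: add_nonneg_pos)
    then show "((\<lambda>d. \<kappa> * ln (d\<^sup>2 + \<epsilon>)) has_real_derivative
        \<kappa> * (2 * (x k - x j) / ((x k - x j)\<^sup>2 + \<epsilon>))) (at (x k - x j))" for x :: "nat \<Rightarrow> real"
      by (auto intro!: derivative_eq_intros)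
  qed
  ultimately have "has_partial i
     (\<lambda>x. (\<Sum>l<N. - (1/2) * \<kappa> * (x l)\<^sup>2) + (\<Sum>k<N. \<Sum>j<k. \<kappa> * ln ((x k - x j)\<^sup>2 + \<epsilon>)))
     (\<lambda>x. (\<Sum>l<N. - \<kappa> * (x l * of_bool (l = i))) +
       (\<Sum>k<N. \<Sum>j<k. \<kappa> * (2 * (x k - x j) / ((x k - x j)\<^sup>2 + \<epsilon>)) * (of_bool (k = i) - of_bool (j = i))))"
    by (intro has_partial_add has_partial_sum)
  from has_partial_chain [OF this DERIV_exp] show ?thesis
    by (simp only: reg_weight_eq_exp [OF assms, symmetric])
qed

section \<open>The loop equation\<close>

definition power_sum :: "nat \<Rightarrow> nat \<Rightarrow> (nat \<Rightarrow> real) \<Rightarrow> real" where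
  "power_sum N q x = (\<Sum>l<N. x l ^ q)"

lemma poly_bounded_power_sum: "poly_bounded N (power_sum N q)"
  unfolding power_sum_def by (intro poly_bounded_sum poly_bounded_power poly_bounded_coord) simp

lemma poly_bounded_abs:
  assumes "poly_bounded N f" shows "poly_bounded N (\<lambda>x. \<bar>f x\<bar>)"
  using assms
  by (rule poly_bounded_dominated) (use assms in \<open>auto simp: poly_bounded_def intro: borel_measurable_abs\<close>)

text \<open>The constant \<open>1 / \<epsilon>\<close> blows up as \<open>\<epsilon>\<close> tends
  to 0, but this lemma serves only at fixed \<open>\<epsilon>\<close>. The uniform bound is obtained
  in \<open>loop_equation\<close> after symmetrisation.\<close>

lemma poly_bounded_inverse_reg:
  assumes "0 < \<epsilon>" "k < N" "j < N"
  shows "poly_bounded N (\<lambda>x. 1 / ((x k - x j)\<^sup>2 + \<epsilon>))"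
proof (rule poly_bounded_dominated [OF poly_bounded_const [of N "1 / \<epsilon>"]])
  have "(\<lambda>x. x k - x j) \<in> borel_measurable (PiM {..<N} (\<lambda>_. lborel :: real measure))"
    by (intro borel_measurable_diff coord_measurable assms)
  then show "(\<lambda>x. 1 / ((x k - x j)\<^sup>2 + \<epsilon>)) \<in> borel_measurable (PiM {..<N} (\<lambda>_. lborel))"
    by (rule measurable_compose [where g = "\<lambda>d. 1 / (d\<^sup>2 + \<epsilon>)"]) measurable
  show "\<bar>1 / ((x k - x j)\<^sup>2 + \<epsilon>)\<bar> \<le> \<bar>1 / \<epsilon>\<bar>" for x :: "nat \<Rightarrow> real"
    using assms(1) by (auto simp: frac_le abs_of_pos add_nonneg_pos)
qed

lemmas poly_bounded_intros =
  poly_bounded_add poly_bounded_diff poly_bounded_mult poly_bounded_sum poly_bounded_power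
  poly_bounded_const poly_bounded_power_sum poly_bounded_abs

section \<open>Symmetrisation of the interaction term\<close>

lemma sum_times_of_bool:
  fixes y :: "nat \<Rightarrow> real"
  shows "k < N \<Longrightarrow> (\<Sum>i<N. y i * of_bool (k = i)) = y k"
  by simp

text \<open>A pair acts on its two members with opposite signs. Summation over \<open>i\<close>
  therefore leaves the difference \<open>y k - y j\<close>, and for \<open>y k = x k ^ n\<close>
  this has the factor \<open>x k - x j\<close> that cancels the singularity.\<close>

lemma sum_times_pair_of_bool:
  fixes y :: "nat \<Rightarrow> real"
  shows "(\<Sum>i<N. y i * (\<Sum>k<N. \<Sum>j<k. c k j * (of_bool (k = i) - of_bool (j = i))))
    = (\<Sum>k<N. \<Sum>j<k. c k j * (y k - y j))"
proof -
  have "(\<Sum>i<N. y i * (\<Sum>k<N. \<Sum>j<k. c k j * (of_bool (k = i) - of_bool (j = i))))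
      = (\<Sum>i<N. \<Sum>k<N. \<Sum>j<k. c k j * (y i * of_bool (k = i) - y i * of_bool (j = i)))"
    by (simp add: sum_distrib_left algebra_simps)
  also have "\<dots> = (\<Sum>k<N. \<Sum>i<N. \<Sum>j<k. c k j * (y i * of_bool (k = i) - y i * of_bool (j = i)))"
    by (rule sum.swap)
  also have "\<dots> = (\<Sum>k<N. \<Sum>j<k. \<Sum>i<N. c k j * (y i * of_bool (k = i) - y i * of_bool (j = i)))"
    by (intro sum.cong refl sum.swap)
  also have "\<dots> = (\<Sum>k<N. \<Sum>j<k. c k j * (y k - y j))"
    by (intro sum.cong refl) (simp only: sum_subtractf sum_times_of_bool lessThan_iff
        order.strict_trans flip: sum_distrib_left)
  finally show ?thesis .
qed

text \<open>Given as a polynomial instead of a quotient, so that it has the correct value on the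
  diagonal.\<close>

definition diff_quot :: "nat \<Rightarrow> real \<Rightarrow> real \<Rightarrow> real" where
  "diff_quot n a b = (\<Sum>s<n. b ^ (n - Suc s) * a ^ s)"

lemma diff_quot_eq: "a ^ n - b ^ n = (a - b) * diff_quot n a b"
  unfolding diff_quot_def by (rule power_diff_sumr2)

lemma diff_quot_commute: "diff_quot n a b = diff_quot n b a"
  unfolding diff_quot_def
  by (rule sum.reindex_bij_witness [of _ "\<lambda>s. n - Suc s" "\<lambda>s. n - Suc s"]) (auto simp: mult.commute)

lemma sum_symmetric_pairs:
  fixes h :: "nat \<Rightarrow> nat \<Rightarrow> real"
  assumes "\<And>k j. h k j = h j k"
  shows "(\<Sum>k<N. \<Sum>j<k. 2 * h k j) = (\<Sum>k<N. \<Sum>j<N. h k j) - (\<Sum>k<N. h k k)"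
proof (induction N)
  case (Suc N)
  have "(\<Sum>k<N. h k N) = (\<Sum>k<N. h N k)" using assms by simp
  then show ?case using Suc by (simp add: sum.distrib flip: sum_distrib_left)
qed simp

text \<open>Over all ordered pairs, each monomial of the quotient factors into two power sums. The
  subtracted term is the diagonal, where the quotient equals \<open>n * a ^ (n - 1)\<close>.\<close>

lemma sum_pairs_diff_quot:
  "(\<Sum>k<N. \<Sum>j<k. 2 * diff_quot n (x k) (x j))
    = (\<Sum>s<n. power_sum N s x * power_sum N (n - Suc s) x) - n * power_sum N (n - 1) x"
proof -
  have "(\<Sum>k<N. \<Sum>j<N. diff_quot n (x k) (x j)) = (\<Sum>k<N. \<Sum>s<n. \<Sum>j<N. x j ^ (n - Suc s) * x k ^ s)"
    unfolding diff_quot_def by (intro sum.cong refl sum.swap)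
  also have "\<dots> = (\<Sum>s<n. \<Sum>k<N. \<Sum>j<N. x j ^ (n - Suc s) * x k ^ s)"
    by (rule sum.swap)
  also have "\<dots> = (\<Sum>s<n. power_sum N s x * power_sum N (n - Suc s) x)"
    by (simp add: power_sum_def sum_product mult.commute)
  finally have *: "(\<Sum>k<N. \<Sum>j<N. diff_quot n (x k) (x j)) = \<dots>" .
  have "diff_quot n a a = n * a ^ (n - 1)" for a :: real
  proof -
    have "a ^ (n - Suc s) * a ^ s = a ^ (n - 1)" if "s < n" for s
      using that by (simp flip: power_add)
    then show ?thesis unfolding diff_quot_def by simp
  qed
  then have "(\<Sum>k<N. diff_quot n (x k) (x k)) = n * power_sum N (n - 1) x"
    by (simp add: power_sum_def sum_distrib_left)
  with * show ?thesis
    using sum_symmetric_pairs [of "\<lambda>k j. diff_quot n (x k) (x j)" N] diff_quot_commute by simp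
qed

text \<open>The divergence of the vector field with components
  \<open>x i ^ n * f x * reg_weight N \<kappa> \<epsilon> x\<close> integrates to 0; the four terms
  come from differentiating the power, \<open>f\<close>, the Gaussian factor and the
  interaction.\<close>

lemma reg_loop_equation:
  assumes "0 < \<epsilon>" "\<epsilon> \<le> 1" "0 < \<kappa>" and f: "poly_bounded N f"
    and partial: "\<And>i. i < N \<Longrightarrow> has_partial i f (f' i)" and f': "\<And>i. i < N \<Longrightarrow> poly_bounded N (f' i)"
  shows "(\<integral>x. (n * power_sum N (n - 1) x * f x + (\<Sum>i<N. x i ^ n * f' i x)
      - \<kappa> * power_sum N (Suc n) x * f x
      + \<kappa> * f x * (\<Sum>k<N. \<Sum>j<k. 2 * (x k - x j) / ((x k - x j)\<^sup>2 + \<epsilon>) * (x k ^ n - x j ^ n)))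
    * reg_weight N \<kappa> \<epsilon> x \<partial>(PiM {..<N} (\<lambda>_. lborel))) = 0"
proof -
  let ?P = "PiM {..<N} (\<lambda>_. lborel :: real measure)"
  let ?c = "\<lambda>x k j. \<kappa> * (2 * (x k - x j) / ((x k - x j)\<^sup>2 + \<epsilon>))"
  \<comment> \<open>The \<open>i\<close>-th partial derivative of
    \<open>x i ^ n * f x * reg_weight N \<kappa> \<epsilon> x\<close>, with the weight divided
    out.\<close>
  define g where "g i x = n * x i ^ (n - 1) * f x + x i ^ n * f' i x
    + f x * x i ^ n * (\<Sum>l<N. - \<kappa> * (x l * of_bool (l = i)))
    + f x * (x i ^ n * (\<Sum>k<N. \<Sum>j<k. ?c x k j * (of_bool (k = i) - of_bool (j = i))))" for i and x :: "nat \<Rightarrow> real"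
  have g: "poly_bounded N (g i)" if "i < N" for i
  proof -
    have "poly_bounded N (\<lambda>x. 2 * (x k - x j) / ((x k - x j)\<^sup>2 + \<epsilon>))" if "k < N" "j < k" for k j
    proof -
      have "poly_bounded N (\<lambda>x. 2 * ((x k - x j) * (1 / ((x k - x j)\<^sup>2 + \<epsilon>))))"
        using that assms(1) by (intro poly_bounded_intros poly_bounded_inverse_reg poly_bounded_coord) auto
      then show ?thesis by simp
    qed
    then show ?thesis
      unfolding g_def using \<open>i < N\<close> f f'
      by (intro poly_bounded_intros poly_bounded_coord) auto
  qed
  have int: "integrable ?P (\<lambda>x. g i x * reg_weight N \<kappa> \<epsilon> x)" if "i < N" for i
    using assms(1-3) g [OF that] by (intro integrable_poly_bounded) auto
  have zero: "(\<integral>x. g i x * reg_weight N \<kappa> \<epsilon> x \<partial>?P) = 0" if i: "i < N" for i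
  proof -
    have "poly_bounded N (\<lambda>x. x i ^ n * f x)"
      using i f by (intro poly_bounded_intros poly_bounded_coord)
    then obtain C where C: "\<And>x. \<bar>x i ^ n * f x * reg_weight N \<kappa> \<epsilon> x\<bar> \<le> C * (\<Prod>l<N. exp (- (\<kappa>/4) * (x l)\<^sup>2))"
      using poly_bounded_times_weight_le [OF less_imp_le [OF assms(1)] assms(2,3)] by blast
    obtain C' where C': "\<And>x. \<bar>g i x * reg_weight N \<kappa> \<epsilon> x\<bar> \<le> C' * (\<Prod>l<N. exp (- (\<kappa>/4) * (x l)\<^sup>2))"
      using poly_bounded_times_weight_le [OF less_imp_le [OF assms(1)] assms(2,3) g [OF i]] by blast
    have "has_partial i (\<lambda>x. x i ^ n) (\<lambda>x. n * x i ^ (n - 1) * of_bool (i = i))"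
      by (rule has_partial_chain [OF has_partial_coord]) (auto intro!: derivative_eq_intros)
    from has_partial_mult [OF has_partial_mult [OF this partial [OF i]] has_partial_reg_weight [OF assms(1), of i N \<kappa>]]
    have "has_partial i (\<lambda>x. x i ^ n * f x * reg_weight N \<kappa> \<epsilon> x) (\<lambda>x. g i x * reg_weight N \<kappa> \<epsilon> x)"
      unfolding g_def by (simp add: algebra_simps)
    from integral_partial_eq_0 [OF _ i this borel_measurable_integrable [OF int [OF i]] C C'] assms(3)
    show ?thesis by simp
  qed
  have "(\<Sum>i<N. g i x) = n * power_sum N (n - 1) x * f x + (\<Sum>i<N. x i ^ n * f' i x)
      - \<kappa> * power_sum N (Suc n) x * f x
      + \<kappa> * f x * (\<Sum>k<N. \<Sum>j<k. 2 * (x k - x j) / ((x k - x j)\<^sup>2 + \<epsilon>) * (x k ^ n - x j ^ n))" for x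
  proof -
    have 1: "(\<Sum>i<N. f x * x i ^ n * (\<Sum>l<N. - \<kappa> * (x l * of_bool (l = i)))) = - \<kappa> * power_sum N (Suc n) x * f x"
    proof -
      have "(\<Sum>l<N. - \<kappa> * (x l * of_bool (l = i))) = - \<kappa> * x i" if "i < N" for i
        unfolding sum_distrib_left [symmetric] using that by simp
      then have "(\<Sum>i<N. f x * x i ^ n * (\<Sum>l<N. - \<kappa> * (x l * of_bool (l = i)))) = (\<Sum>i<N. (- \<kappa> * f x) * x i ^ Suc n)"
        by (intro sum.cong refl) simp
      then show ?thesis
        by (simp only: power_sum_def mult_ac flip: sum_distrib_left)
    qed
    have 2: "(\<Sum>i<N. f x * (x i ^ n * (\<Sum>k<N. \<Sum>j<k. ?c x k j * (of_bool (k = i) - of_bool (j = i)))))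
        = \<kappa> * f x * (\<Sum>k<N. \<Sum>j<k. 2 * (x k - x j) / ((x k - x j)\<^sup>2 + \<epsilon>) * (x k ^ n - x j ^ n))"
      unfolding sum_distrib_left [symmetric] sum_times_pair_of_bool
      by (simp add: sum_distrib_left mult_ac)
    have 3: "(\<Sum>i<N. n * x i ^ (n - 1) * f x) = n * power_sum N (n - 1) x * f x"
      by (simp add: power_sum_def sum_distrib_left sum_distrib_right)
    show ?thesis
      unfolding g_def sum.distrib 1 2 3 by simp
  qed
  moreover have "(\<integral>x. (\<Sum>i<N. g i x) * reg_weight N \<kappa> \<epsilon> x \<partial>?P) = 0"
    unfolding sum_distrib_right using int zero by (subst Bochner_Integration.integral_sum) auto
  ultimately show ?thesis by simp
qed

section \<open>Removal of the regularisation\<close>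

lemma reg_weight_tendsto:
  assumes "0 < \<kappa>" shows "(\<lambda>m. reg_weight N \<kappa> (1 / Suc m) x) \<longlonglongrightarrow> reg_weight N \<kappa> 0 x"
proof -
  have "(\<lambda>m. 1 / real (Suc m)) \<longlonglongrightarrow> 0"
    by (rule LIMSEQ_Suc [OF lim_1_over_n])
  then have "(\<lambda>m. ((x k - x j)\<^sup>2 + 1 / real (Suc m)) powr \<kappa>) \<longlonglongrightarrow> ((x k - x j)\<^sup>2 + 0) powr \<kappa>" for k j
    using assms by (intro tendsto_powr' tendsto_intros) auto
  then show ?thesis
    unfolding reg_weight_def by (intro tendsto_mult tendsto_const tendsto_prod)
qed

lemma reg_quotient_tendsto:
  fixes d :: real
  assumes "d \<noteq> 0" shows "(\<lambda>m. d\<^sup>2 / (d\<^sup>2 + 1 / Suc m)) \<longlonglongrightarrow> 1"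
proof -
  have "(\<lambda>m. d\<^sup>2 / (d\<^sup>2 + 1 / Suc m)) \<longlonglongrightarrow> d\<^sup>2 / (d\<^sup>2 + 0)"
    using assms LIMSEQ_Suc [OF lim_1_over_n [where 'a = real]] by (intro tendsto_intros) auto
  then show ?thesis using assms by simp
qed

text \<open>Handles the points with \<open>x k = x j\<close>, where the regularised quotient stays
  at 0 instead of tending to 1: there the limiting weight kills the discrepancy.\<close>

lemma reg_weight_0_eq_0:
  assumes "k < N" "j < k" "x k = x j" shows "reg_weight N \<kappa> 0 x = 0"
proof -
  have "(\<Prod>j<k. ((x k - x j)^2 + 0) powr \<kappa>) = 0"
    using assms by (intro prod_zero) auto
  then have "(\<Prod>k<N. \<Prod>j<k. ((x k - x j)^2 + 0) powr \<kappa>) = 0"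
    using assms(1) by (intro prod_zero) auto
  then show ?thesis unfolding reg_weight_def by simp
qed

lemma loop_equation:
  assumes "0 < \<kappa>" and f: "poly_bounded N f"
    and partial: "\<And>i. i < N \<Longrightarrow> has_partial i f (f' i)" and f': "\<And>i. i < N \<Longrightarrow> poly_bounded N (f' i)"
  shows "(\<integral>x. (n * power_sum N (n - 1) x * f x + (\<Sum>i<N. x i ^ n * f' i x)
      - \<kappa> * power_sum N (Suc n) x * f x
      + \<kappa> * f x * (\<Sum>k<N. \<Sum>j<k. 2 * diff_quot n (x k) (x j)))
    * reg_weight N \<kappa> 0 x \<partial>(PiM {..<N} (\<lambda>_. lborel))) = 0"
proof -
  let ?P = "PiM {..<N} (\<lambda>_. lborel :: real measure)"
  define A where "A x = n * power_sum N (n - 1) x * f x + (\<Sum>i<N. x i ^ n * f' i x)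
    - \<kappa> * power_sum N (Suc n) x * f x" for x
  define r where "r \<epsilon> x k j = 2 * (x k - x j) / ((x k - x j)\<^sup>2 + \<epsilon>) * (x k ^ n - x j ^ n)" 
    for \<epsilon> :: real and x :: "nat \<Rightarrow> real" and k j
  \<comment> \<open>\<open>T\<close> is the regularised bracket, \<open>T0\<close> its formal limit
    and \<open>B\<close> a majorant independent of \<open>\<epsilon>\<close>.\<close>
  define T where "T \<epsilon> x = A x + \<kappa> * f x * (\<Sum>k<N. \<Sum>j<k. r \<epsilon> x k j)" for \<epsilon> x
  define T0 where "T0 x = A x + \<kappa> * f x * (\<Sum>k<N. \<Sum>j<k. 2 * diff_quot n (x k) (x j))" for x
  define B where "B x = \<bar>A x\<bar> + \<kappa> * \<bar>f x\<bar> * (\<Sum>k<N. \<Sum>j<k. 2 * \<bar>diff_quot n (x k) (x j)\<bar>)" for x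
  \<comment> \<open>The last factor lies between 0 and 1 for positive \<open>\<epsilon>\<close>,
    which makes the bound uniform in \<open>\<epsilon>\<close>.\<close>
  have r: "r \<epsilon> x k j = 2 * diff_quot n (x k) (x j) * ((x k - x j)\<^sup>2 / ((x k - x j)\<^sup>2 + \<epsilon>))" for \<epsilon> x k j
    unfolding r_def diff_quot_eq by (simp add: power2_eq_square)
  have A: "poly_bounded N A"
    unfolding A_def using f f' by (intro poly_bounded_intros poly_bounded_coord) auto
  have quot: "poly_bounded N (\<lambda>x. diff_quot n (x k) (x j))" if "k < N" "j < k" for k j
    unfolding diff_quot_def using that by (intro poly_bounded_intros poly_bounded_coord) auto
  have B: "poly_bounded N B" and T0: "poly_bounded N T0"
    unfolding B_def T0_def using f A quot by (intro poly_bounded_intros; simp)+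
  have T: "poly_bounded N (T \<epsilon>)" if "0 < \<epsilon>" for \<epsilon>
  proof -
    have "poly_bounded N (\<lambda>x. r \<epsilon> x k j)" if "k < N" "j < k" for k j
    proof -
      have "poly_bounded N (\<lambda>x. 2 * diff_quot n (x k) (x j) * ((x k - x j)\<^sup>2 * (1 / ((x k - x j)\<^sup>2 + \<epsilon>))))"
        using that quot \<open>0 < \<epsilon>\<close>
        by (intro poly_bounded_intros poly_bounded_inverse_reg poly_bounded_coord) auto
      then show ?thesis unfolding r by simp
    qed
    then show ?thesis
      unfolding T_def using f A by (intro poly_bounded_intros) auto
  qed
  have bound: "\<bar>T \<epsilon> x\<bar> \<le> B x" if "0 < \<epsilon>" for \<epsilon> x
  proof -
    have "\<bar>r \<epsilon> x k j\<bar> \<le> 2 * \<bar>diff_quot n (x k) (x j)\<bar>" for k j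
    proof -
      have "\<bar>(x k - x j)\<^sup>2 / ((x k - x j)\<^sup>2 + \<epsilon>)\<bar> \<le> 1"
        using that by (auto simp: abs_divide divide_le_eq_1 intro: add_nonneg_pos)
      from mult_left_mono [OF this, of "2 * \<bar>diff_quot n (x k) (x j)\<bar>"] show ?thesis
        unfolding r abs_mult by simp
    qed
    then have "\<bar>\<Sum>k<N. \<Sum>j<k. r \<epsilon> x k j\<bar> \<le> (\<Sum>k<N. \<Sum>j<k. 2 * \<bar>diff_quot n (x k) (x j)\<bar>)"
      by (intro order_trans [OF sum_abs] sum_mono order_trans [OF sum_abs])
    then have "\<bar>\<kappa> * f x * (\<Sum>k<N. \<Sum>j<k. r \<epsilon> x k j)\<bar>
        \<le> \<kappa> * \<bar>f x\<bar> * (\<Sum>k<N. \<Sum>j<k. 2 * \<bar>diff_quot n (x k) (x j)\<bar>)"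
      unfolding abs_mult using assms(1) by (simp add: mult_left_mono)
    then show ?thesis unfolding T_def B_def by linarith
  qed
  have lim: "(\<lambda>m. T (1 / Suc m) x * reg_weight N \<kappa> (1 / Suc m) x) \<longlonglongrightarrow> T0 x * reg_weight N \<kappa> 0 x" for x
  proof -
    have "(\<lambda>m. r (1 / Suc m) x k j * reg_weight N \<kappa> (1 / Suc m) x)
        \<longlonglongrightarrow> 2 * diff_quot n (x k) (x j) * reg_weight N \<kappa> 0 x" if "k < N" "j < k" for k j
    proof (cases "x k = x j")
      case True
      with reg_weight_0_eq_0 [OF that True] show ?thesis by (simp add: r)
    next
      case False
      then have "(\<lambda>m. 2 * diff_quot n (x k) (x j) * ((x k - x j)\<^sup>2 / ((x k - x j)\<^sup>2 + 1 / Suc m)) * reg_weight N \<kappa> (1 / Suc m) x)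
          \<longlonglongrightarrow> 2 * diff_quot n (x k) (x j) * 1 * reg_weight N \<kappa> 0 x"
        using assms(1) by (intro tendsto_mult tendsto_const reg_quotient_tendsto reg_weight_tendsto) auto
      then show ?thesis unfolding r by simp
    qed
    then have "(\<lambda>m. A x * reg_weight N \<kappa> (1 / Suc m) x
          + \<kappa> * f x * (\<Sum>k<N. \<Sum>j<k. r (1 / Suc m) x k j * reg_weight N \<kappa> (1 / Suc m) x))
        \<longlonglongrightarrow> A x * reg_weight N \<kappa> 0 x
          + \<kappa> * f x * (\<Sum>k<N. \<Sum>j<k. 2 * diff_quot n (x k) (x j) * reg_weight N \<kappa> 0 x)"
      using assms(1) by (intro tendsto_add tendsto_mult_left tendsto_sum reg_weight_tendsto) auto
    then show ?thesis
      unfolding T_def T0_def distrib_right mult.assoc sum_distrib_right .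
  qed
  have "(\<lambda>m. \<integral>x. T (1 / Suc m) x * reg_weight N \<kappa> (1 / Suc m) x \<partial>?P) \<longlonglongrightarrow> (\<integral>x. T0 x * reg_weight N \<kappa> 0 x \<partial>?P)"
  proof (rule integral_dominated_convergence [where w = "\<lambda>x. B x * reg_weight N \<kappa> 1 x"])
    show "integrable ?P (\<lambda>x. B x * reg_weight N \<kappa> 1 x)"
      using B assms(1) by (intro integrable_poly_bounded) auto
    show "(\<lambda>x. T0 x * reg_weight N \<kappa> 0 x) \<in> borel_measurable ?P"
      "\<And>m. (\<lambda>x. T (1 / Suc m) x * reg_weight N \<kappa> (1 / Suc m) x) \<in> borel_measurable ?P"
      using T0 T unfolding poly_bounded_def by (intro borel_measurable_times reg_weight_measurable; simp)+
    show "AE x in ?P. norm (T (1 / Suc m) x * reg_weight N \<kappa> (1 / Suc m) x) \<le> B x * reg_weight N \<kappa> 1 x" for m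
    proof (rule AE_I2)
      fix x
      have "\<bar>T (1 / Suc m) x\<bar> \<le> B x" by (rule bound) simp
      moreover have "reg_weight N \<kappa> (1 / Suc m) x \<le> reg_weight N \<kappa> 1 x"
        using assms(1) by (intro reg_weight_mono) auto
      ultimately show "norm (T (1 / Suc m) x * reg_weight N \<kappa> (1 / Suc m) x) \<le> B x * reg_weight N \<kappa> 1 x"
        using reg_weight_nonneg by (simp add: abs_mult mult_mono')
    qed
  qed (rule AE_I2, rule lim)
  moreover have "(\<integral>x. T (1 / Suc m) x * reg_weight N \<kappa> (1 / Suc m) x \<partial>?P) = 0" for m
    unfolding T_def A_def r_def using assms(1) f partial f' by (intro reg_loop_equation) auto
  ultimately show ?thesis
    unfolding T0_def A_def by (simp add: LIMSEQ_const_iff)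
qed

section \<open>Correlators of power sums\<close>

text \<open>The intervals are pairwise disjoint and ordered, so coordinates taken from them are
  distinct and no factor vanishes.\<close>

lemma gbe_weight_pos_on_box:
  assumes "\<And>l. l < N \<Longrightarrow> x l \<in> {2 * real l..2 * real l + 1}"
  shows "0 < gbe_weight N \<kappa> x"
proof -
  have "x j < x k" if "k < N" "j < k" for k j
    using assms [of k] assms [of j] that by auto
  then have "0 < \<bar>x k - x j\<bar> powr (2 * \<kappa>)" if "k < N" "j < k" for k j
    using that by (metis less_irrefl powr_gt_zero abs_zero eq_iff_diff_eq_0 zero_less_abs_iff)
  then show ?thesis
    unfolding gbe_weight_def by (intro mult_pos_pos prod_pos) auto
qed

text \<open>Were the integral 0, the nonnegative integrable weight would vanish almost everywhere;
  but it is positive on a box of measure 1.\<close>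

lemma gbe_partition_function_pos:
  assumes "0 < \<kappa>" shows "0 < gbe_partition_function N \<kappa>"
proof -
  interpret product_sigma_finite "\<lambda>_ :: nat. lborel :: real measure" ..
  let ?P = "PiM {..<N} (\<lambda>_. lborel :: real measure)"
  let ?S = "PiE {..<N} (\<lambda>l. {2 * real l..2 * real l + 1})"
  have int: "integrable ?P (gbe_weight N \<kappa>)"
    using integrable_poly_bounded [of 0 \<kappa> N "\<lambda>_. 1"] assms by (simp add: poly_bounded_const reg_weight_0)
  have nonneg: "0 \<le> gbe_weight N \<kappa> x" for x
    using reg_weight_nonneg [of N \<kappa> 0 x] by (simp add: reg_weight_0)
  have "gbe_partition_function N \<kappa> \<noteq> 0"
  proof
    assume "gbe_partition_function N \<kappa> = 0"
    then have "AE x in ?P. gbe_weight N \<kappa> x = 0"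
      unfolding gbe_partition_function_def
      by (subst (asm) integral_nonneg_eq_0_iff_AE) (auto simp: int nonneg)
    then have "AE x in ?P. x \<notin> ?S"
    proof (rule eventually_mono, intro notI)
      fix x assume "gbe_weight N \<kappa> x = 0" "x \<in> ?S"
      moreover have "0 < gbe_weight N \<kappa> x"
        by (rule gbe_weight_pos_on_box) (use \<open>x \<in> ?S\<close> in \<open>blast dest: PiE_mem\<close>)
      ultimately show False by simp
    qed
    moreover have "?S \<in> sets ?P"
      by (intro sets_PiM_I_finite) auto
    ultimately have "emeasure ?P ?S = 0"
      by (simp add: AE_iff_null_sets null_setsD1)
    moreover have "emeasure ?P ?S = (\<Prod>l<N. emeasure lborel {2 * real l..2 * real l + 1})"
      by (intro emeasure_PiM) auto
    ultimately show False by simp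
  qed
  moreover have "0 \<le> gbe_partition_function N \<kappa>"
    unfolding gbe_partition_function_def by (intro integral_nonneg_AE AE_I2 nonneg)
  ultimately show ?thesis by simp
qed

lemma gbe_eq_density:
  "gbe N \<kappa> = density (PiM {..<N} (\<lambda>_. lborel)) (\<lambda>x. ennreal (reg_weight N \<kappa> 0 x / gbe_partition_function N \<kappa>))"
  by (simp add: gbe_def reg_weight_0)

text \<open>Positivity of the partition function makes the density nonnegative, so
  \<open>ennreal\<close> truncates nothing and expectations become Lebesgue integrals.\<close>

lemma
  assumes "0 < \<kappa>" "poly_bounded N f"
  shows integrable_gbe: "integrable (gbe N \<kappa>) f"
    and integral_gbe: "(\<integral>x. f x \<partial>gbe N \<kappa>) =
      (\<integral>x. f x * reg_weight N \<kappa> 0 x \<partial>(PiM {..<N} (\<lambda>_. lborel))) / gbe_partition_function N \<kappa>"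
proof -
  let ?P = "PiM {..<N} (\<lambda>_. lborel :: real measure)"
  let ?w = "\<lambda>x. reg_weight N \<kappa> 0 x / gbe_partition_function N \<kappa>"
  have f: "f \<in> borel_measurable ?P"
    using assms(2) unfolding poly_bounded_def by blast
  have w: "?w \<in> borel_measurable ?P"
    by (intro borel_measurable_divide reg_weight_measurable) simp
  have nonneg: "AE x in ?P. 0 \<le> ?w x"
    using gbe_partition_function_pos [OF assms(1), of N] by (intro AE_I2) (simp add: reg_weight_nonneg)
  have eq: "?w x *\<^sub>R f x = f x * reg_weight N \<kappa> 0 x / gbe_partition_function N \<kappa>" for x
    by simp
  have "integrable ?P (\<lambda>x. f x * reg_weight N \<kappa> 0 x)"
    using assms by (intro integrable_poly_bounded) auto
  then show "integrable (gbe N \<kappa>) f"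
    unfolding gbe_eq_density integrable_density [OF f w nonneg] eq by (rule integrable_divide)
  show "(\<integral>x. f x \<partial>gbe N \<kappa>) = (\<integral>x. f x * reg_weight N \<kappa> 0 x \<partial>?P) / gbe_partition_function N \<kappa>"
    unfolding gbe_eq_density integral_density [OF f w nonneg] eq by simp
qed

text \<open>Only the multiset of exponents matters. A list singles out the head for the recursion,
  and sorting supplies a normal form for rewriting.\<close>

definition gbe_corr :: "nat \<Rightarrow> real \<Rightarrow> nat list \<Rightarrow> real" where
  "gbe_corr N \<kappa> qs = (\<integral>x. (\<Prod>q\<leftarrow>qs. power_sum N q x) \<partial>gbe N \<kappa>)"

lemma poly_bounded_prod_power_sum: "poly_bounded N (\<lambda>x. \<Prod>q\<leftarrow>qs. power_sum N q x)"
  by (induction qs) (simp_all add: poly_bounded_intros)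

lemma poly_bounded_sum_list:
  "(\<And>q. poly_bounded N (g q)) \<Longrightarrow> poly_bounded N (\<lambda>x. \<Sum>q\<leftarrow>qs. g q x)"
  by (induction qs) (simp_all add: poly_bounded_intros)

lemma integral_gbe_sum_list:
  assumes "0 < \<kappa>" "\<And>q. poly_bounded N (g q)"
  shows "(\<integral>x. (\<Sum>q\<leftarrow>qs. g q x) \<partial>gbe N \<kappa>) = (\<Sum>q\<leftarrow>qs. \<integral>x. g q x \<partial>gbe N \<kappa>)"
  by (induction qs) (simp_all add: Bochner_Integration.integral_add integrable_gbe assms poly_bounded_sum_list)

lemma
  assumes "0 < \<kappa>" "poly_bounded N f" "poly_bounded N g"
  shows integral_gbe_add: "(\<integral>x. f x + g x \<partial>gbe N \<kappa>) = (\<integral>x. f x \<partial>gbe N \<kappa>) + (\<integral>x. g x \<partial>gbe N \<kappa>)"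
    and integral_gbe_diff: "(\<integral>x. f x - g x \<partial>gbe N \<kappa>) = (\<integral>x. f x \<partial>gbe N \<kappa>) - (\<integral>x. g x \<partial>gbe N \<kappa>)"
  using assms by (simp_all add: Bochner_Integration.integral_add Bochner_Integration.integral_diff integrable_gbe)

lemma gbe_corr_mset: "mset qs = mset rs \<Longrightarrow> gbe_corr N \<kappa> qs = gbe_corr N \<kappa> rs"
  unfolding gbe_corr_def by (simp only: prod_mset_prod_list [symmetric] mset_map)

lemma gbe_corr_sort: "gbe_corr N \<kappa> qs = gbe_corr N \<kappa> (sort qs)"
  by (rule gbe_corr_mset) simp

lemma gbe_corr_0: "gbe_corr N \<kappa> (0 # qs) = N * gbe_corr N \<kappa> qs"
  by (simp add: gbe_corr_def power_sum_def)

lemma gbe_corr_Nil: "0 < \<kappa> \<Longrightarrow> gbe_corr N \<kappa> [] = 1"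
  using gbe_partition_function_pos [of \<kappa> N] integral_gbe [of \<kappa> N "\<lambda>_. 1"]
  by (simp add: gbe_corr_def poly_bounded_const reg_weight_0 gbe_partition_function_def)

lemma prod_list_map_remove1:
  fixes g :: "'a \<Rightarrow> 'b :: comm_monoid_mult"
  shows "q \<in> set qs \<Longrightarrow> prod_list (map g qs) = g q * prod_list (map g (remove1 q qs))"
  by (induction qs) (auto simp: mult.left_commute)

text \<open>Leibniz rule. With repeated exponents \<open>remove1\<close> may drop another occurrence
  than the differentiated one, but the remaining product is the same.\<close>

lemma has_partial_prod_power_sum:
  assumes "i < N"
  shows "has_partial i (\<lambda>x. \<Prod>q\<leftarrow>qs. power_sum N q x)
    (\<lambda>x. \<Sum>q\<leftarrow>qs. q * x i ^ (q - 1) * (\<Prod>r\<leftarrow>remove1 q qs. power_sum N r x))"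
proof (induction qs)
  case Nil
  then show ?case by (simp add: has_partial_const)
next
  case (Cons a qs)
  have "has_partial i (\<lambda>x. x l ^ a) (\<lambda>x. a * x l ^ (a - 1) * of_bool (l = i))" for l
    by (rule has_partial_chain [OF has_partial_coord]) (auto intro!: derivative_eq_intros)
  then have "has_partial i (power_sum N a) (\<lambda>x. \<Sum>l<N. a * x l ^ (a - 1) * of_bool (l = i))"
    unfolding power_sum_def [abs_def] by (rule has_partial_sum)
  then have "has_partial i (power_sum N a) (\<lambda>x. a * x i ^ (a - 1))"
    using assms by simp
  from has_partial_mult [OF this Cons.IH]
  have "has_partial i (\<lambda>x. power_sum N a x * (\<Prod>q\<leftarrow>qs. power_sum N q x))
    (\<lambda>x. a * x i ^ (a - 1) * (\<Prod>q\<leftarrow>qs. power_sum N q x)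
      + power_sum N a x * (\<Sum>q\<leftarrow>qs. q * x i ^ (q - 1) * (\<Prod>r\<leftarrow>remove1 q qs. power_sum N r x)))" .
  moreover have "power_sum N a x * (\<Sum>q\<leftarrow>qs. q * x i ^ (q - 1) * (\<Prod>r\<leftarrow>remove1 q qs. power_sum N r x))
      = (\<Sum>q\<leftarrow>qs. q * x i ^ (q - 1) * (\<Prod>r\<leftarrow>remove1 q (a # qs). power_sum N r x))" for x :: "nat \<Rightarrow> real"
    unfolding sum_list_const_mult [symmetric]
    by (intro arg_cong [where f = sum_list] map_cong refl)
      (auto simp: prod_list_map_remove1 [of a qs "\<lambda>r. power_sum N r x"])
  ultimately show ?case by simp
qed

lemma sum_partials_prod_power_sum:
  fixes x :: "nat \<Rightarrow> real"
  shows "(\<Sum>i<N. x i ^ n * (\<Sum>q\<leftarrow>qs. q * x i ^ (q - 1) * (\<Prod>r\<leftarrow>remove1 q qs. power_sum N r x)))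
    = (\<Sum>q\<leftarrow>qs. q * (\<Prod>r\<leftarrow>(n + q - 1) # remove1 q qs. power_sum N r x))"
proof -
  have swap: "(\<Sum>i<N. \<Sum>q\<leftarrow>rs. g q i) = (\<Sum>q\<leftarrow>rs. \<Sum>i<N. g q i)" for rs and g :: "nat \<Rightarrow> nat \<Rightarrow> real"
    by (induction rs) (simp_all add: sum.distrib)
  have pull: "(\<Sum>i<N. q * (x i ^ m * P)) = q * (power_sum N m x * P)" for q m and P :: real
    by (simp add: power_sum_def sum_distrib_left sum_distrib_right)
  \<comment> \<open>For \<open>q = 0\<close> the truncated exponents on the two sides may differ,
    but the factor \<open>q\<close> annihilates both.\<close>
  have "x i ^ n * (q * x i ^ (q - 1) * P) = q * (x i ^ (n + q - 1) * P)" for i q and P :: real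
    by (cases q) (simp_all add: power_add)
  then have "(\<Sum>i<N. x i ^ n * (\<Sum>q\<leftarrow>qs. q * x i ^ (q - 1) * (\<Prod>r\<leftarrow>remove1 q qs. power_sum N r x)))
      = (\<Sum>q\<leftarrow>qs. \<Sum>i<N. q * (x i ^ (n + q - 1) * (\<Prod>r\<leftarrow>remove1 q qs. power_sum N r x)))"
    by (simp only: sum_list_const_mult [symmetric] swap)
  also have "\<dots> = (\<Sum>q\<leftarrow>qs. q * (\<Prod>r\<leftarrow>(n + q - 1) # remove1 q qs. power_sum N r x))"
    by (simp only: pull list.map prod_list.Cons)
  finally show ?thesis .
qed

text \<open>The expectation of the loop equation for \<open>f\<close> the product over
  \<open>qs\<close>, divided by \<open>\<kappa>\<close>. The first sum comes from the interaction,
  the last from differentiating \<open>f\<close>; the middle coefficient joins the derivative of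
  \<open>x i ^ n\<close> (\<open>1/\<kappa>\<close>) to the diagonal correction (\<open>-1\<close>).
  For \<open>n = 0\<close> the truncated \<open>n - 1\<close> has coefficient 0.\<close>

lemma gbe_corr_loop:
  assumes "0 < \<kappa>"
  shows "gbe_corr N \<kappa> (Suc n # qs) =
    (\<Sum>s<n. gbe_corr N \<kappa> (s # (n - Suc s) # qs))
    + (1/\<kappa> - 1) * n * gbe_corr N \<kappa> ((n - 1) # qs)
    + 1/\<kappa> * (\<Sum>q\<leftarrow>qs. q * gbe_corr N \<kappa> ((n + q - 1) # remove1 q qs))"
proof -
  let ?E = "\<lambda>f. \<integral>x. f x \<partial>gbe N \<kappa>"
  let ?p = "\<lambda>qs x. \<Prod>q\<leftarrow>qs. power_sum N q x"
  let ?D = "\<lambda>x. \<Sum>q\<leftarrow>qs. q * ?p ((n + q - 1) # remove1 q qs) x"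
  let ?S = "\<lambda>x. \<Sum>s<n. ?p (s # (n - Suc s) # qs) x"
  \<comment> \<open>The bracket of \<open>loop_equation\<close>, rewritten entirely in products of
    power sums.\<close>
  define h where "h x = n * ?p ((n - 1) # qs) x + ?D x - \<kappa> * ?p (Suc n # qs) x
    + \<kappa> * (?S x - n * ?p ((n - 1) # qs) x)" for x
  have D: "poly_bounded N ?D"
    by (intro poly_bounded_sum_list poly_bounded_mult poly_bounded_const poly_bounded_prod_power_sum)
  have S: "poly_bounded N ?S"
    by (intro poly_bounded_sum poly_bounded_prod_power_sum)
  have h: "poly_bounded N h"
    unfolding h_def
    by (intro poly_bounded_add poly_bounded_diff poly_bounded_mult poly_bounded_const D S poly_bounded_prod_power_sum)
  have h_eq: "h x = n * power_sum N (n - 1) x * ?p qs x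
      + (\<Sum>i<N. x i ^ n * (\<Sum>q\<leftarrow>qs. q * x i ^ (q - 1) * ?p (remove1 q qs) x))
      - \<kappa> * power_sum N (Suc n) x * ?p qs x
      + \<kappa> * ?p qs x * (\<Sum>k<N. \<Sum>j<k. 2 * diff_quot n (x k) (x j))" for x :: "nat \<Rightarrow> real"
    unfolding h_def sum_partials_prod_power_sum sum_pairs_diff_quot
    by (simp add: algebra_simps sum_distrib_left)
  have "?E h = 0"
    unfolding integral_gbe [OF assms h] unfolding h_eq
    by (subst loop_equation [OF assms poly_bounded_prod_power_sum has_partial_prod_power_sum])
      (auto intro!: poly_bounded_sum_list poly_bounded_mult poly_bounded_const poly_bounded_power
        poly_bounded_coord poly_bounded_prod_power_sum)
  moreover have "?E h = n * gbe_corr N \<kappa> ((n - 1) # qs) + ?E ?D - \<kappa> * gbe_corr N \<kappa> (Suc n # qs)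
      + \<kappa> * (?E ?S - n * gbe_corr N \<kappa> ((n - 1) # qs))"
    unfolding h_def gbe_corr_def
    by (simp only: integral_gbe_add integral_gbe_diff integral_mult_right_zero assms D S
        poly_bounded_add poly_bounded_diff poly_bounded_mult poly_bounded_const poly_bounded_prod_power_sum)
  moreover have "?E ?D = (\<Sum>q\<leftarrow>qs. q * gbe_corr N \<kappa> ((n + q - 1) # remove1 q qs))"
    unfolding gbe_corr_def
    by (subst integral_gbe_sum_list [OF assms])
      (simp_all only: poly_bounded_mult poly_bounded_const poly_bounded_prod_power_sum integral_mult_right_zero)
  moreover have "?E ?S = (\<Sum>s<n. gbe_corr N \<kappa> (s # (n - Suc s) # qs))"
    unfolding gbe_corr_def
    by (intro Bochner_Integration.integral_sum integrable_gbe assms poly_bounded_prod_power_sum)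
  ultimately show ?thesis
    using assms by (simp add: field_simps)
qed

section \<open>Evaluation of the recursion up to degree twelve\<close>

lemma gbe_moment_eq_corr: "gbe_moment q N \<kappa> = gbe_corr N \<kappa> [q]"
  by (simp add: gbe_moment_def gbe_corr_def power_sum_def)

theorem mainTheorem2:
  fixes N :: nat and \<kappa> :: real
  assumes "N \<ge> 1" and "\<kappa> > 0"
  shows
    "(gbe_moment 0 N \<kappa> = real N) \<and>
     (gbe_moment 2 N \<kappa> = real N^2 + real N * (-1 + 1/\<kappa>)) \<and>
     (gbe_moment 4 N \<kappa> = 2 * real N^3 + 5 * real N^2 * (-1 + 1/\<kappa>)
       + real N * (3 - 5/\<kappa> + 3/\<kappa>^2)) \<and>
     (gbe_moment 6 N \<kappa> = 5 * real N^4 + 22 * real N^3 * (-1 + 1/\<kappa>)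
       + real N^2 * (32 - 54/\<kappa> + 32/\<kappa>^2)
       + real N * (-15 + 32/\<kappa> - 32/\<kappa>^2 + 15/\<kappa>^3)) \<and>
     (gbe_moment 8 N \<kappa> = 14 * real N^5 + 93 * real N^4 * (-1 + 1/\<kappa>)
       + real N^3 * (234 - 398/\<kappa> + 234/\<kappa>^2)
       + real N^2 * (-260 + 565/\<kappa> - 565/\<kappa>^2 + 260/\<kappa>^3)
       + real N * (105 - 260/\<kappa> + 331/\<kappa>^2 - 260/\<kappa>^3 + 105/\<kappa>^4)) \<and>
     (gbe_moment 10 N \<kappa> = 42 * real N^6 + 386 * real N^5 * (-1 + 1/\<kappa>)
       + 10 * real N^4 * (145 - 248/\<kappa> + 145/\<kappa>^2)
       + 550 * real N^3 * (-5 + 11/\<kappa> - 11/\<kappa>^2 + 5/\<kappa>^3)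
       + real N^2 * (2589 - 6545/\<kappa> + 8395/\<kappa>^2 - 6545/\<kappa>^3 + 2589/\<kappa>^4)
       + real N * (-945 + 2589/\<kappa> - 3795/\<kappa>^2 + 3795/\<kappa>^3 - 2589/\<kappa>^4 + 945/\<kappa>^5)) \<and>
     (gbe_moment 12 N \<kappa> = 132 * real N^7 + 1586 * real N^6 * (-1 + 1/\<kappa>)
       + real N^5 * (8178 - 14046/\<kappa> + 8178/\<kappa>^2)
       + real N^4 * (-22950 + 50945/\<kappa> - 50945/\<kappa>^2 + 22950/\<kappa>^3)
       + 4 * real N^3 * (9125 - 23403/\<kappa> + 30173/\<kappa>^2 - 23403/\<kappa>^3 + 9125/\<kappa>^4)
       + real N^2 * (-30669 + 85796/\<kappa> - 127221/\<kappa>^2 + 127221/\<kappa>^3 - 85796/\<kappa>^4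
           + 30669/\<kappa>^5)
       + 3 * real N * (3465 - 10223/\<kappa> + 16432/\<kappa>^2 - 18853/\<kappa>^3 + 16432/\<kappa>^4
           - 10223/\<kappa>^5 + 3465/\<kappa>^6))"
proof -
  define C where "C = gbe_corr N \<kappa>"
  define n x where "n = real N" and "x = 1 / \<kappa>"
  \<comment> \<open>The recursion with \<open>n = k - 1\<close>. Sorting the right-hand lists makes
    them match the correlators computed below, and puts the smallest exponent at the head, which
    keeps the splitting sum short.\<close>
  have loop: "C (k # qs) = (\<Sum>s<k - 1. C (sort (s # (k - 2 - s) # qs)))
      + (x - 1) * real (k - 1) * C (sort ((k - 2) # qs))
      + x * (\<Sum>q\<leftarrow>qs. q * C (sort ((k + q - 2) # remove1 q qs)))" if "0 < k" for k qs
    using gbe_corr_loop [OF assms(2), of N "k - 1" qs] that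
    unfolding C_def x_def gbe_corr_sort [symmetric] by (simp add: numeral_2_eq_2)
  have C0: "C (0 # qs) = n * C qs" for qs
    unfolding C_def n_def by (rule gbe_corr_0)
  have CNil: "C [] = 1"
    unfolding C_def by (rule gbe_corr_Nil [OF assms(2)])
  have lessThan_1: "{..<1} = {0 :: nat}" by auto
  \<comment> \<open>Explicit index sets unfold the sums; the exponent 1 must stay \<open>1\<close>
    rather than \<open>Suc 0\<close> for the stored correlators to match.\<close>
  note eval = lessThan_1 lessThan_nat_numeral C0 CNil One_nat_def [symmetric]
  \<comment> \<open>The correlators follow in order of total degree 2, 4, ..., 12, only those that
    the recursion reaches. Each takes one loop step, substitution of known values, and a polynomial
    identity in \<open>n\<close> and \<open>x\<close> where simplification leaves one.\<close>
  have c1_1: "C [1, 1] = x * n"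
    by (subst loop, simp, simp add: eval del: One_nat_def, algebra?)
  have c2: "C [2] = n^2 + (-1 + x) * n"
    by (subst loop, simp, simp add: eval del: One_nat_def, algebra?)
  have c1_3: "C [1, 3] = 3 * x * n^2 + (-3 * x + 3 * x^2) * n"
    by (subst loop, simp, simp add: eval c2 del: One_nat_def, algebra?)
  have c2_2: "C [2, 2] = n^4 + (-2 + 2 * x) * n^3 + (1 + x^2) * n^2 + (-2 * x + 2 * x^2) * n"
    by (subst loop, simp, simp add: eval c2 del: One_nat_def, algebra?)
  have c4: "C [4] = 2 * n^3 + (-5 + 5 * x) * n^2 + (3 - 5 * x + 3 * x^2) * n"
    by (subst loop, simp, simp add: eval c1_1 c2 del: One_nat_def, algebra?)
  have c1_1_4: "C [1, 1, 4] = 2 * x * n^4 + (-5 * x + 5 * x^2) * n^3 + (3 * x + 7 * x^2 + 3 * x^3) *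
      n^2 + (-12 * x^2 + 12 * x^3) * n"
    by (subst loop, simp, simp add: eval c1_3 c4 del: One_nat_def, algebra?)
  have c1_5: "C [1, 5] = 10 * x * n^3 + (-25 * x + 25 * x^2) * n^2 + (15 * x - 25 * x^2 + 15 * x^3)
      * n"
    by (subst loop, simp, simp add: eval c4 del: One_nat_def, algebra?)
  have c2_4: "C [2, 4] = 2 * n^5 + (-7 + 7 * x) * n^4 + (8 - 7 * x + 8 * x^2) * n^3 + (-3 - 12 * x +
      12 * x^2 + 3 * x^3) * n^2 + (12 * x - 20 * x^2 + 12 * x^3) * n"
    by (subst loop, simp, simp add: eval c4 del: One_nat_def, algebra?)
  have c3_3: "C [3, 3] = 12 * x * n^3 + (-27 * x + 27 * x^2) * n^2 + (15 * x - 27 * x^2 + 15 * x^3)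
      * n"
    by (subst loop, simp, simp add: eval c1_3 c4 del: One_nat_def, algebra?)
  have c6: "C [6] = 5 * n^4 + (-22 + 22 * x) * n^3 + (32 - 54 * x + 32 * x^2) * n^2 + (-15 + 32 * x
      - 32 * x^2 + 15 * x^3) * n"
    by (subst loop, simp, simp add: eval c1_3 c2_2 c4 del: One_nat_def, algebra?)
  have c1_1_6: "C [1, 1, 6] = 5 * x * n^5 + (-22 * x + 22 * x^2) * n^4 + (32 * x + 6 * x^2 + 32 *
      x^3) * n^3 + (-15 * x - 118 * x^2 + 118 * x^3 + 15 * x^4) * n^2 + (90 * x^2 - 150 * x^3 + 90 *
      x^4) * n"
    by (subst loop, simp, simp add: eval c1_5 c6 del: One_nat_def, algebra?)
  have c1_2_5: "C [1, 2, 5] = 10 * x * n^5 + (-35 * x + 35 * x^2) * n^4 + (40 * x - 15 * x^2 + 40 *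
      x^3) * n^3 + (-15 * x - 110 * x^2 + 110 * x^3 + 15 * x^4) * n^2 + (90 * x^2 - 150 * x^3 + 90 *
      x^4) * n"
    by (subst loop, simp, simp add: eval c1_5 c2_4 del: One_nat_def, algebra?)
  have c1_7: "C [1, 7] = 35 * x * n^4 + (-154 * x + 154 * x^2) * n^3 + (224 * x - 378 * x^2 + 224 *
      x^3) * n^2 + (-105 * x + 224 * x^2 - 224 * x^3 + 105 * x^4) * n"
    by (subst loop, simp, simp add: eval c6 del: One_nat_def, algebra?)
  have c2_6: "C [2, 6] = 5 * n^6 + (-27 + 27 * x) * n^5 + (54 - 68 * x + 54 * x^2) * n^4 + (-47 - 14
      * x + 14 * x^2 + 47 * x^3) * n^3 + (15 + 145 * x - 260 * x^2 + 145 * x^3 + 15 * x^4) * n^2 +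
      (-90 * x + 192 * x^2 - 192 * x^3 + 90 * x^4) * n"
    by (subst loop, simp, simp add: eval c6 del: One_nat_def, algebra?)
  have c3_5: "C [3, 5] = 45 * x * n^4 + (-180 * x + 180 * x^2) * n^3 + (240 * x - 420 * x^2 + 240 *
      x^3) * n^2 + (-105 * x + 240 * x^2 - 240 * x^3 + 105 * x^4) * n"
    by (subst loop, simp, simp add: eval c1_5 c6 del: One_nat_def, algebra?)
  have c4_4: "C [4, 4] = 4 * n^6 + (-20 + 20 * x) * n^5 + (37 - 34 * x + 37 * x^2) * n^4 + (-30 - 72
      * x + 72 * x^2 + 30 * x^3) * n^3 + (9 + 182 * x - 321 * x^2 + 182 * x^3 + 9 * x^4) * n^2 +
      (-96 * x + 212 * x^2 - 212 * x^3 + 96 * x^4) * n"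
    by (subst loop, simp, simp add: eval c1_1_4 c2_4 c6 del: One_nat_def, algebra?)
  have c8: "C [8] = 14 * n^5 + (-93 + 93 * x) * n^4 + (234 - 398 * x + 234 * x^2) * n^3 + (-260 +
      565 * x - 565 * x^2 + 260 * x^3) * n^2 + (105 - 260 * x + 331 * x^2 - 260 * x^3 + 105 * x^4) *
      n"
    by (subst loop, simp, simp add: eval c1_5 c2_4 c3_3 c6 del: One_nat_def, algebra?)
  have c1_9: "C [1, 9] = 126 * x * n^5 + (-837 * x + 837 * x^2) * n^4 + (2106 * x - 3582 * x^2 +
      2106 * x^3) * n^3 + (-2340 * x + 5085 * x^2 - 5085 * x^3 + 2340 * x^4) * n^2 + (945 * x - 2340
      * x^2 + 2979 * x^3 - 2340 * x^4 + 945 * x^5) * n"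
    by (subst loop, simp, simp add: eval c8 del: One_nat_def, algebra?)
  have c2_8: "C [2, 8] = 14 * n^7 + (-107 + 107 * x) * n^6 + (327 - 472 * x + 327 * x^2) * n^5 +
      (-494 + 453 * x - 453 * x^2 + 494 * x^3) * n^4 + (365 + 787 * x - 1723 * x^2 + 787 * x^3 + 365
      * x^4) * n^3 + (-105 - 1715 * x + 3929 * x^2 - 3929 * x^3 + 1715 * x^4 + 105 * x^5) * n^2 +
      (840 * x - 2080 * x^2 + 2648 * x^3 - 2080 * x^4 + 840 * x^5) * n"
    by (subst loop, simp, simp add: eval c8 del: One_nat_def, algebra?)
  have c3_7: "C [3, 7] = 168 * x * n^5 + (-1029 * x + 1029 * x^2) * n^4 + (2394 * x - 4158 * x^2 +
      2394 * x^3) * n^3 + (-2478 * x + 5607 * x^2 - 5607 * x^3 + 2478 * x^4) * n^2 + (945 * x - 2478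
      * x^2 + 3213 * x^3 - 2478 * x^4 + 945 * x^5) * n"
    by (subst loop, simp, simp add: eval c1_7 c8 del: One_nat_def, algebra?)
  have c4_6: "C [4, 6] = 10 * n^7 + (-69 + 69 * x) * n^6 + (189 - 209 * x + 189 * x^2) * n^5 + (-256
      - 242 * x + 242 * x^2 + 256 * x^3) * n^4 + (171 + 1627 * x - 2986 * x^2 + 1627 * x^3 + 171 *
      x^4) * n^3 + (-45 - 2145 * x + 4871 * x^2 - 4871 * x^3 + 2145 * x^4 + 45 * x^5) * n^2 + (900 *
      x - 2316 * x^2 + 2988 * x^3 - 2316 * x^4 + 900 * x^5) * n"
    by (subst loop, simp, simp add: eval c1_1_6 c2_6 c8 del: One_nat_def, algebra?)
  have c5_5: "C [5, 5] = 180 * x * n^5 + (-1075 * x + 1075 * x^2) * n^4 + (2450 * x - 4300 * x^2 +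
      2450 * x^3) * n^3 + (-2500 * x + 5725 * x^2 - 5725 * x^3 + 2500 * x^4) * n^2 + (945 * x - 2500
      * x^2 + 3275 * x^3 - 2500 * x^4 + 945 * x^5) * n"
    by (subst loop, simp, simp add: eval c1_2_5 c3_5 c8 del: One_nat_def, algebra?)
  have c10: "C [10] = 42 * n^6 + (-386 + 386 * x) * n^5 + (1450 - 2480 * x + 1450 * x^2) * n^4 +
      (-2750 + 6050 * x - 6050 * x^2 + 2750 * x^3) * n^3 + (2589 - 6545 * x + 8395 * x^2 - 6545 *
      x^3 + 2589 * x^4) * n^2 + (-945 + 2589 * x - 3795 * x^2 + 3795 * x^3 - 2589 * x^4 + 945 * x^5)
      * n"
    by (subst loop, simp, simp add: eval c1_7 c2_6 c3_5 c4_4 c8 del: One_nat_def, algebra?)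
  have c12: "C [12] = 132 * n^7 + (-1586 + 1586 * x) * n^6 + (8178 - 14046 * x + 8178 * x^2) * n^5 +
      (-22950 + 50945 * x - 50945 * x^2 + 22950 * x^3) * n^4 + (36500 - 93612 * x + 120692 * x^2 -
      93612 * x^3 + 36500 * x^4) * n^3 + (-30669 + 85796 * x - 127221 * x^2 + 127221 * x^3 - 85796 *
      x^4 + 30669 * x^5) * n^2 + (10395 - 30669 * x + 49296 * x^2 - 56559 * x^3 + 49296 * x^4 -
      30669 * x^5 + 10395 * x^6) * n"
    by (subst loop, simp, simp add: eval c10 c1_9 c2_8 c3_7 c4_6 c5_5 del: One_nat_def, algebra?)
  \<comment> \<open>Replaces division by \<open>\<kappa>\<close> with powers of \<open>x\<close>, so
    that the claimed formulas too become polynomial identities in \<open>n\<close> and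
    \<open>x\<close>.\<close>
  have inv: "a / \<kappa> = a * x" "a / \<kappa> ^ k = a * x ^ k" for a k
    by (simp_all add: x_def power_one_over)
  note to_x = gbe_moment_eq_corr C_def [symmetric] n_def [symmetric] inv
  show ?thesis
    by (intro conjI;
        simp only: to_x C0 CNil c2 c4 c6 c8 c10 c12;
        algebra)
qed

end
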